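(* Fix $r\ge 1$. For $1\le j\le r$ let $x_j=e^{z_j}$ and $y_j=e^{w_j}$, and suppose $x_1\cdots x_r=y_1\cdots y_r$ (i.e. $w_r=z_1+\cdots+z_r-w_1-\cdots-w_{r-1}$). Then $$\prod_{j=1}^r\frac{(x_jq)_\infty}{(y_jq)_\infty}\in\mathbf{qMZV}[[z_1,\dots,z_r,w_1,\dots,w_{r-1}]],$$ its constant term is $1$, and the coefficient of $z_1^{m_1}\cdots z_r^{m_r}w_1^{n_1}\cdots w_{r-1}^{n_{r-1}}$ has weight $m_1+\cdots+m_r+n_1+\cdots+n_{r-1}$.
   Context: Here $q$ is a formal variable and $(a)_\infty=(a;q)_\infty=\prod_{n\ge 0}(1-aq^n)$; all expressions are regarded as formal power series. For integers $s_1,\dots,s_\ell\ge 1$ the bracket is $$[s_1,\dots,s_\ell]=\frac{1}{(s_1-1)!\cdots(s_\ell-1)!}\sum_{\substack{n_1>\cdots>n_\ell\ge 1\\ d_1,\dots,d_\ell\ge 1}} d_1^{s_1-1}\cdots d_\ell^{s_\ell-1}\,q^{n_1d_1+\cdots+n_\ell d_\ell}\in\mathbb{Q}[[q]].$$ $\mathbf{qMZV}$ denotes the $\mathbb{Q}$-linear span of $1$ and Okounkov's multiple $q$-zeta values $Z(s_1,\dots,s_\ell)=\sum_{n_1>\cdots>n_\ell\ge1}\prod_{i=1}^\ell \frac{Q_{s_i}(q^{n_i})}{(1-q^{n_i})^{s_i}}$ ($s_i\ge 2$), where $Q_s(t)=t^{s/2}$ for $s$ even and $Q_s(t)=t^{(s-1)/2}(t+1)$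 for $s$ odd. It is known (Bachmann–Kühn) that $\mathbf{qMZV}$ is a $\mathbb{Q}$-algebra and equals the $\mathbb{Q}$-linear span of $1$ and all brackets $[s_1,\dots,s_\ell]$ with all $s_i\ge 2$. An element of $\mathbf{qMZV}$ is said to have weight $w$ if it is a $\mathbb{Q}$-linear combination of products of brackets $[s_1,\dots,s_\ell]$ with all entries $\ge 2$, in each of which products the sum of all entries of all factors equals $w$ (the constant $1$ has weight $0$). *)

theory Defs
  imports "HOL-Analysis.Analysis" "HOL-Library.Poly_Mapping"
begin

typedef ('v, 'a) mps = "UNIV :: (('v \<Rightarrow>\<^sub>0 nat) \<Rightarrow> 'a) set"
  morphisms mps_coeff Abs_mps
  by simp

lemma mps_coeff_Abs [simp]: "mps_coeff (Abs_mps f) = f"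
  by (simp add: Abs_mps_inverse)

lemma mps_eq_iff: "f = g \<longleftrightarrow> (\<forall>m. mps_coeff f m = mps_coeff g m)"
  by (metis ext mps_coeff_inject)

definition add_splits :: "('v \<Rightarrow>\<^sub>0 nat) \<Rightarrow> (('v \<Rightarrow>\<^sub>0 nat) \<times> ('v \<Rightarrow>\<^sub>0 nat)) set" where
  "add_splits m = {(a, b). a + b = m}"

lemma finite_add_splits [simp]: "finite (add_splits (m :: 'v \<Rightarrow>\<^sub>0 nat))"
proof -
  define D where "D = {a. \<exists>b. a + b = m}"
  define \<phi> where "\<phi> = (\<lambda>a :: 'v \<Rightarrow>\<^sub>0 nat. restrict (Poly_Mapping.lookup a) (Poly_Mapping.keys m))"
  have le: "Poly_Mapping.lookup a k \<le> Poly_Mapping.lookup m k" if "a \<in> D" for a k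
    using that by (auto simp: D_def lookup_add)
  have "inj_on \<phi> D"
  proof (rule inj_onI)
    fix a b assume ab: "a \<in> D" "b \<in> D" "\<phi> a = \<phi> b"
    show "a = b"
    proof (rule poly_mapping_eqI)
      fix k
      show "Poly_Mapping.lookup a k = Poly_Mapping.lookup b k"
      proof (cases "k \<in> Poly_Mapping.keys m")
        case True
        then show ?thesis using ab(3) by (metis \<phi>_def restrict_apply')
      next
        case False
        then show ?thesis using le[OF ab(1), of k] le[OF ab(2), of k]
          by (simp add: in_keys_iff)
      qed
    qed
  qed
  moreover have "\<phi> ` D \<subseteq> (\<Pi>\<^sub>E k \<in> Poly_Mapping.keys m. {..Poly_Mapping.lookup m k})"
    using le by (auto simp: \<phi>_def)
  then have "finite (\<phi> ` D)"
    by (rule finite_subset) (auto intro: finite_PiE)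
  ultimately have D: "finite D"
    by (blast dest: finite_imageD)
  have "add_splits m \<subseteq> D \<times> D"
    by (auto simp: D_def add_splits_def) (metis add.commute)
  then show ?thesis
    using D by (blast intro: finite_subset)
qed

instantiation mps :: (type, comm_ring_1) comm_ring_1
begin

definition zero_mps_def: "0 = Abs_mps (\<lambda>m. 0)"
definition one_mps_def: "1 = Abs_mps (\<lambda>m. if m = 0 then 1 else 0)"
definition plus_mps_def: "f + g = Abs_mps (\<lambda>m. mps_coeff f m + mps_coeff g m)"
definition minus_mps_def: "f - g = Abs_mps (\<lambda>m. mps_coeff f m - mps_coeff g m)"
definition uminus_mps_def: "- f = Abs_mps (\<lambda>m. - mps_coeff f m)"
definition times_mps_def:
  "f * g = Abs_mps (\<lambda>m. \<Sum>(a, b) \<in> add_splits m. mps_coeff f a * mps_coeff g b)"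

instance
proof
  fix f g h :: "('a, 'b) mps"
  show "f + g + h = f + (g + h)" "f + g = g + f" "0 + f = f" "- f + f = 0" "f - g = f + - g"
    by (simp_all add: mps_eq_iff plus_mps_def zero_mps_def uminus_mps_def minus_mps_def)
  show "(0 :: ('a, 'b) mps) \<noteq> 1"
    by (auto simp: mps_eq_iff zero_mps_def one_mps_def)
  show "(f + g) * h = f * h + g * h"
    by (simp add: mps_eq_iff times_mps_def plus_mps_def ring_distribs sum.distrib case_prod_unfold)
  show "f * g = g * f"
  proof -
    have "(\<Sum>(a, b) \<in> add_splits m. mps_coeff f a * mps_coeff g b) =
          (\<Sum>(a, b) \<in> add_splits m. mps_coeff g a * mps_coeff f b)" for m
      by (rule sum.reindex_bij_witness[of _ prod.swap prod.swap])
         (auto simp: add_splits_def mult.commute add.commute)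
    then show ?thesis by (simp add: mps_eq_iff times_mps_def)
  qed
  show "1 * f = f"
  proof -
    have "(\<Sum>(a, b) \<in> add_splits m. (if a = 0 then 1 else 0) * mps_coeff f b) = mps_coeff f m" for m :: "'a \<Rightarrow>\<^sub>0 nat"
    proof -
      have "(\<Sum>(a, b) \<in> add_splits m. (if a = 0 then 1 else 0) * mps_coeff f b) =
            (\<Sum>(a, b) \<in> {(0 :: 'a \<Rightarrow>\<^sub>0 nat, m)}. (if a = 0 then 1 else 0) * mps_coeff f b)"
        by (rule sum.mono_neutral_right[OF finite_add_splits]) (auto simp: add_splits_def split: if_splits)
      then show ?thesis by simp
    qed
    then show ?thesis by (simp add: mps_eq_iff times_mps_def one_mps_def)
  qed
  show "f * g * h = f * (g * h)"
  proof -
    have "(\<Sum>(a, b) \<in> add_splits m.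
             (\<Sum>(c, d) \<in> add_splits a. mps_coeff f c * mps_coeff g d) * mps_coeff h b) =
          (\<Sum>(a, b) \<in> add_splits m.
             mps_coeff f a * (\<Sum>(c, d) \<in> add_splits b. mps_coeff g c * mps_coeff h d))"
      (is "?L = ?R") for m
    proof -
      have "?L = (\<Sum>p \<in> add_splits m. \<Sum>q \<in> add_splits (fst p).
                   mps_coeff f (fst q) * mps_coeff g (snd q) * mps_coeff h (snd p))"
        by (simp add: sum_distrib_right case_prod_unfold)
      also have "\<dots> = (\<Sum>(p, q) \<in> Sigma (add_splits m) (\<lambda>p. add_splits (fst p)).
                   mps_coeff f (fst q) * mps_coeff g (snd q) * mps_coeff h (snd p))"
        by (rule sum.Sigma) auto
      also have "\<dots> = (\<Sum>(p, q) \<in> Sigma (add_splits m) (\<lambda>p. add_splits (snd p)).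
                   mps_coeff f (fst p) * (mps_coeff g (fst q) * mps_coeff h (snd q)))"
        by (rule sum.reindex_bij_witness[of _
              "\<lambda>(p, q). ((fst p + fst q, snd q), (fst p, fst q))"
              "\<lambda>(p, q). ((fst q, snd q + snd p), (snd q, snd p))"])
           (auto simp: add_splits_def add.assoc mult.assoc)
      also have "\<dots> = (\<Sum>p \<in> add_splits m. \<Sum>q \<in> add_splits (snd p).
                   mps_coeff f (fst p) * (mps_coeff g (fst q) * mps_coeff h (snd q)))"
        by (rule sum.Sigma [symmetric]) auto
      also have "\<dots> = ?R"
        by (simp add: sum_distrib_left case_prod_unfold)
      finally show ?thesis .
    qed
    then show ?thesis by (simp add: mps_eq_iff times_mps_def)
  qed
qed

end

text \<open>The partial inverse, 0 on non-units; it makes the library's division on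
  \<^typ>\<open>('v, 'a) mps fps\<close> available.\<close>

instantiation mps :: (type, comm_ring_1) inverse
begin

definition inverse_mps_def:
  "inverse (f :: ('a, 'b) mps) = (if \<exists>g. f * g = 1 then THE g. f * g = 1 else 0)"
definition divide_mps_def: "(f :: ('a, 'b) mps) div g = f * inverse g"

instance ..

end

lemma mps_inverse_unique:
  fixes f g :: "('v, 'a :: comm_ring_1) mps"
  assumes "f * g = 1"
  shows "inverse f = g"
proof -
  have "g' = g" if "f * g' = 1" for g'
  proof -
    have "g' = (f * g) * g'" by (simp add: assms)
    also have "\<dots> = (f * g') * g" by (simp add: mult_ac)
    finally show ?thesis by (simp add: that)
  qed
  with assms have "(THE g. f * g = 1) = g"
    by (rule the_equality)
  moreover have "\<exists>g. f * g = 1"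
    using assms by (rule exI)
  ultimately show ?thesis
    by (simp only: inverse_mps_def if_True)
qed

lemma mps_inverse_1 [simp]: "inverse (1 :: ('v, 'a :: comm_ring_1) mps) = 1"
  by (rule mps_inverse_unique) simp

definition mps_var :: "'v \<Rightarrow> ('v, 'a :: comm_ring_1) mps" where
  "mps_var v = Abs_mps (\<lambda>m. if m = Poly_Mapping.single v 1 then 1 else 0)"

definition total_deg :: "('v \<Rightarrow>\<^sub>0 nat) \<Rightarrow> nat" where
  "total_deg m = (\<Sum>v\<in>Poly_Mapping.keys m. Poly_Mapping.lookup m v)"

text \<open>Substitution of \<open>f\<close> into a univariate series, for \<open>f\<close> without constant term (as for
  \<^const>\<open>fps_compose\<close>): then \<open>f ^ k\<close> has no monomials of total degree less than \<open>k\<close>, so the sum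
  below is the full coefficient of \<open>\<Sum>k. a\<^sub>k f\<^sup>k\<close>.\<close>

definition mps_compose :: "'a :: comm_ring_1 fps \<Rightarrow> ('v, 'a) mps \<Rightarrow> ('v, 'a) mps" where
  "mps_compose a f = Abs_mps (\<lambda>m. \<Sum>k\<le>total_deg m. fps_nth a k * mps_coeff (f ^ k) m)"

definition mps_exp :: "('v, 'a :: field_char_0) mps \<Rightarrow> ('v, 'a) mps" where
  "mps_exp f = mps_compose (fps_exp 1) f"

text \<open>\<open>S[[V]]\<close> for a set \<open>S\<close> of coefficients and a set \<open>V\<close> of variables.\<close>

definition mps_over :: "'a :: zero set \<Rightarrow> 'v set \<Rightarrow> ('v, 'a) mps set" where
  "mps_over S V = {f. (\<forall>m. mps_coeff f m \<in> S) \<and>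
     (\<forall>m. \<not> Poly_Mapping.keys m \<subseteq> V \<longrightarrow> mps_coeff f m = 0)}"

text \<open>The identification of \<open>R[[V]][[q]]\<close> with \<open>R[[q]][[V]]\<close>.\<close>

definition mps_of_fps :: "('v, 'a) mps fps \<Rightarrow> ('v, 'a fps) mps" where
  "mps_of_fps F = Abs_mps (\<lambda>m. Abs_fps (\<lambda>N. mps_coeff (fps_nth F N) m))"

text \<open>Throughout, \<open>q\<close> is \<^const>\<open>fps_X\<close>; infinite products and sums are taken in the \<open>q\<close>-adic
  topology of \<^typ>\<open>'a fps\<close>.\<close>

definition qpoch_inf :: "'a :: comm_ring_1 fps \<Rightarrow> 'a fps" where
  "qpoch_inf a = prodinf (\<lambda>n. 1 - a * fps_X ^ n)"

definition decr_lists :: "nat \<Rightarrow> nat list set" where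
  "decr_lists l = {ns. length ns = l \<and> sorted_wrt (>) ns \<and> (\<forall>n\<in>set ns. n \<ge> 1)}"

definition pos_lists :: "nat \<Rightarrow> nat list set" where
  "pos_lists l = {ds. length ds = l \<and> (\<forall>d\<in>set ds. d \<ge> 1)}"

definition bracket :: "nat list \<Rightarrow> rat fps" where
  "bracket ss = (let l = length ss in
     fps_const (1 / (\<Prod>i<l. fact (ss ! i - 1))) *
     (\<Sum>\<^sub>\<infinity>(ns, ds) \<in> decr_lists l \<times> pos_lists l.
        fps_const (\<Prod>i<l. of_nat (ds ! i) ^ (ss ! i - 1)) * fps_X ^ (\<Sum>i<l. ns ! i * ds ! i)))"

definition okounkov_Q :: "nat \<Rightarrow> 'a :: comm_ring_1 \<Rightarrow> 'a" where
  "okounkov_Q s t = (if even s then t ^ (s div 2) else t ^ ((s - 1) div 2) * (t + 1))"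

definition okounkov_Z :: "nat list \<Rightarrow> rat fps" where
  "okounkov_Z ss = (\<Sum>\<^sub>\<infinity>ns \<in> decr_lists (length ss).
     \<Prod>i<length ss. okounkov_Q (ss ! i) (fps_X ^ (ns ! i)) / (1 - fps_X ^ (ns ! i)) ^ (ss ! i))"

text \<open>The library has no scalar multiplication of \<^typ>\<open>rat\<close> on \<^typ>\<open>rat fps\<close>.\<close>

interpretation ratfps: vector_space "\<lambda>(c :: rat) (f :: rat fps). fps_const c * f"
  by standard
    (simp_all add: ring_distribs mult.assoc
      flip: fps_const_add fps_const_mult del: fps_const_add fps_const_mult)

definition qMZV :: "rat fps set" where
  "qMZV = ratfps.span (insert 1 {okounkov_Z ss | ss. ss \<noteq> [] \<and> (\<forall>s\<in>set ss. s \<ge> 2)})"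

text \<open>A product of brackets is given by the list of the index lists of its factors; the empty
  product is \<open>1\<close>, of weight \<open>0\<close>.\<close>

definition bracket_products :: "nat \<Rightarrow> rat fps set" where
  "bracket_products k = {prod_list (map bracket sss) | sss.
     (\<forall>ss\<in>set sss. ss \<noteq> [] \<and> (\<forall>s\<in>set ss. s \<ge> 2)) \<and> sum_list (map sum_list sss) = k}"

definition has_weight :: "rat fps \<Rightarrow> nat \<Rightarrow> bool" where
  "has_weight f k \<longleftrightarrow> f \<in> qMZV \<and> f \<in> ratfps.span (bracket_products k)"

datatype zwvar = Z nat | W nat

definition zwvars :: "nat \<Rightarrow> zwvar set" where
  "zwvars r = Z ` {1..r} \<union> W ` {1..r - 1}"

end

theory Submission
  imports Defs
begin

text \<open>
  Let \<open>D\<close> be the Euler derivation in the variables \<open>z, w\<close>, which multiplies a monomial by its total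
  degree. Since \<open>D x = z x\<close> for \<open>x = exp z\<close>, the logarithmic derivative of \<open>(x q)\<^sub>\<infinity>\<close> is
  \<open>- \<Sum>\<^sub>N q\<^sup>N \<Sum>\<^bsub>d | N\<^esub> z x\<^sup>d = - \<Sum>\<^bsub>k \<ge> 1\<^esub> [k] z\<^sup>k\<close>. Hence the product \<open>F\<close> satisfies
  \<open>D F = F \<cdot> \<Sum>\<^bsub>k \<ge> 1\<^esub> [k] (\<Sum>\<^sub>j w\<^sub>j\<^sup>k - z\<^sub>j\<^sup>k)\<close>, where the term for \<open>k = 1\<close> vanishes by the
  hypothesis. This recursion expresses each coefficient of \<open>F\<close> by products of the brackets \<open>[k]\<close>,
  \<open>k \<ge> 2\<close>, of total weight equal to the degree.

  Such products lie in \<open>qMZV\<close> by quasi-shuffling: with \<open>u = t/(1-t)\<^sup>2\<close> and \<open>v = (1+t)/(1-t)\<close>, the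
  terms of Okounkov's sums are \<open>u\<^sup>m\<close> and \<open>u\<^sup>m v\<close> (\<open>m \<ge> 1\<close>). Because \<open>v\<^sup>2 = 1 + 4u\<close>, their span is closed
  under multiplication, and because \<open>t u' = u v\<close> and \<open>t v' = 2u\<close>, it is closed under \<open>t d/dt\<close> and so
  contains \<open>\<Sum>\<^sub>d d\<^sup>k\<^sup>-\<^sup>1 t\<^sup>d\<close> for \<open>k \<ge> 2\<close>.
\<close>

section \<open>The summands of Okounkov's sums\<close>

definition okounkov_term :: "nat \<Rightarrow> rat fps" where
  "okounkov_term s = okounkov_Q s fps_X / (1 - fps_X) ^ s"

text \<open>In terms of u = \<open>geom_u\<close> and v = \<open>geom_v\<close> this is the span of
  all u^m and u^m v with m \<ge> 1.\<close>

definition okounkov_space :: "rat fps set" where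
  "okounkov_space = ratfps.span {okounkov_term s | s. s \<ge> 2}"

definition geom :: "rat fps" where "geom = inverse (1 - fps_X)"
definition geom_u :: "rat fps" where "geom_u = fps_X * geom\<^sup>2"
definition geom_v :: "rat fps" where "geom_v = (1 + fps_X) * geom"

lemma geom_mult: "(1 - fps_X) * geom = 1"
  unfolding geom_def by (rule inverse_mult_eq_1') simp

lemma geom_v_square: "geom_v\<^sup>2 = 1 + 4 * geom_u"
proof -
  have "geom_v\<^sup>2 = ((1 - fps_X) * geom)\<^sup>2 + 4 * geom_u"
    unfolding geom_v_def geom_u_def by (simp add: power2_eq_square algebra_simps)
  then show ?thesis by (simp add: geom_mult)
qed

lemma okounkov_term_conv_geom: "okounkov_term s = okounkov_Q s fps_X * geom ^ s"
  unfolding okounkov_term_def geom_def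
  by (subst fps_divide_unit) (simp_all add: fps_inverse_power fps_power_zeroth)

lemma okounkov_term_even: "okounkov_term (2 * m) = geom_u ^ m"
  by (simp add: okounkov_term_conv_geom okounkov_Q_def geom_u_def power_mult_distrib power_mult)

lemma okounkov_term_odd: "okounkov_term (2 * m + 1) = geom_u ^ m * geom_v"
  by (simp add: okounkov_term_conv_geom okounkov_Q_def geom_u_def geom_v_def power_mult_distrib
      algebra_simps flip: power_mult)

text \<open>The values s = 0 and s = 1 would give 1 and v; from s = 2 on a factor u is always
  present.\<close>

lemma okounkov_term_cases:
  assumes "s \<ge> 2"
  obtains m where "okounkov_term s = geom_u ^ Suc m"
        | m where "okounkov_term s = geom_u ^ Suc m * geom_v"
proof (cases "even s")
  case True
  then obtain k where "s = 2 * k" by (elim evenE)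
  moreover from this assms obtain m where "k = Suc m" by (cases k) auto
  ultimately show ?thesis using that(1) okounkov_term_even by metis
next
  case False
  then obtain k where "s = 2 * k + 1" by (elim oddE)
  moreover from this assms obtain m where "k = Suc m" by (cases k) auto
  ultimately show ?thesis using that(2) okounkov_term_odd by metis
qed

lemma geom_u_power_in_okounkov_space: "geom_u ^ Suc m \<in> okounkov_space"
  using okounkov_term_even[of "Suc m"] unfolding okounkov_space_def
  by (intro ratfps.span_base) (force intro!: exI[of _ "2 * Suc m"])

lemma geom_u_power_mult_v_in_okounkov_space: "geom_u ^ Suc m * geom_v \<in> okounkov_space"
  using okounkov_term_odd[of "Suc m"] unfolding okounkov_space_def
  by (intro ratfps.span_base) (force intro!: exI[of _ "2 * Suc m + 1"])

lemma okounkov_space_add: "a \<in> okounkov_space \<Longrightarrow> b \<in> okounkov_space \<Longrightarrow> a + b \<in> okounkov_space"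
  unfolding okounkov_space_def by (rule ratfps.span_add)

lemma okounkov_space_scale: "a \<in> okounkov_space \<Longrightarrow> fps_const c * a \<in> okounkov_space"
  unfolding okounkov_space_def by (rule ratfps.span_scale)

lemma okounkov_space_zero: "0 \<in> okounkov_space"
  unfolding okounkov_space_def by (rule ratfps.span_zero)

lemma okounkov_space_induct [consumes 1, case_names zero add scale even odd]:
  assumes "a \<in> okounkov_space"
    and "P 0"
    and "\<And>a b. a \<in> okounkov_space \<Longrightarrow> b \<in> okounkov_space \<Longrightarrow> P a \<Longrightarrow> P b \<Longrightarrow> P (a + b)"
    and "\<And>a c. a \<in> okounkov_space \<Longrightarrow> P a \<Longrightarrow> P (fps_const c * a)"
    and "\<And>m. P (geom_u ^ Suc m)"
    and "\<And>m. P (geom_u ^ Suc m * geom_v)"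
  shows "P a"
proof -
  \<comment> \<open>Membership is carried along with \<open>P\<close>: the span induction supplies
    only the claim itself for its partial sums, while the cases for sums and multiples also ask for
    membership.\<close>
  have "a \<in> okounkov_space \<and> P a"
    using assms(1) unfolding okounkov_space_def
  proof (induction rule: ratfps.span_induct_alt)
    case base
    show ?case using assms(2) by (simp add: ratfps.span_zero)
  next
    case (step c x y)
    then obtain s where s: "x = okounkov_term s" "s \<ge> 2" by blast
    have "x \<in> okounkov_space"
      unfolding okounkov_space_def using step(1) by (rule ratfps.span_base)
    moreover have "P x"
      using s(2) by (cases rule: okounkov_term_cases) (use assms s in simp_all)
    ultimately show ?case using step(2) assms(3,4)
      by (metis okounkov_space_add okounkov_space_def okounkov_space_scale)
  qed
  then show ?thesis ..
qed

text \<open>The one case that is not immediate is v times u^m v, which v^2 = 1 + 4u turns back into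
  u^m + 4 u^(m+1).\<close>

lemma geom_mult_okounkov_space:
  assumes "a \<in> okounkov_space"
  shows "geom_u * a \<in> okounkov_space" "geom_v * a \<in> okounkov_space"
proof -
  show "geom_u * a \<in> okounkov_space"
    using assms
  proof (induction rule: okounkov_space_induct)
    case (even m)
    then show ?case using geom_u_power_in_okounkov_space[of "Suc m"] by simp
  next
    case (odd m)
    then show ?case using geom_u_power_mult_v_in_okounkov_space[of "Suc m"] by (simp add: mult.assoc)
  qed (auto simp: okounkov_space_zero distrib_left mult.left_commute[of geom_u "fps_const _"]
        intro: okounkov_space_add okounkov_space_scale)
  show "geom_v * a \<in> okounkov_space"
    using assms
  proof (induction rule: okounkov_space_induct)
    case (even m)
    then show ?case using geom_u_power_mult_v_in_okounkov_space[of m] by (simp add: mult.commute)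
  next
    case (odd m)
    have "geom_v * (geom_u ^ Suc m * geom_v) = geom_u ^ Suc m * geom_v\<^sup>2"
      by (simp add: power2_eq_square mult_ac)
    also have "\<dots> = geom_u ^ Suc m + fps_const 4 * geom_u ^ Suc (Suc m)"
      by (simp add: geom_v_square algebra_simps numeral_fps_const)
    finally show ?case
      by (simp only: okounkov_space_add okounkov_space_scale geom_u_power_in_okounkov_space)
  qed (auto simp: okounkov_space_zero distrib_left mult.left_commute[of geom_v "fps_const _"]
        intro: okounkov_space_add okounkov_space_scale)
qed

lemma okounkov_space_mult:
  assumes "a \<in> okounkov_space" "b \<in> okounkov_space"
  shows "a * b \<in> okounkov_space"
proof -
  have pow: "geom_u ^ m * b \<in> okounkov_space" if "b \<in> okounkov_space" for m b
    using that by (induction m) (simp_all add: mult.assoc geom_mult_okounkov_space)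
  show ?thesis
    using assms(1)
  proof (induction rule: okounkov_space_induct)
    case (even m)
    show ?case using assms(2) by (rule pow)
  next
    case (odd m)
    show ?case using assms(2) pow[of "geom_v * b" "Suc m"] geom_mult_okounkov_space
      by (simp only: mult.assoc)
  qed (auto simp: okounkov_space_zero distrib_right mult.assoc
        intro: okounkov_space_add okounkov_space_scale)
qed

section \<open>The derivation t d/dt and the generating series of powers\<close>

lemma fps_deriv_geom: "fps_deriv geom = geom\<^sup>2"
proof -
  have "fps_deriv ((1 - fps_X) * geom) = 0"
    by (simp only: geom_mult fps_deriv_1)
  then have "(1 - fps_X) * fps_deriv geom = geom"
    by (simp add: fps_deriv_mult)
  then have "geom * ((1 - fps_X) * fps_deriv geom) = geom\<^sup>2"
    by (simp only: power2_eq_square)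
  then show ?thesis
    by (metis geom_mult mult.assoc mult.commute mult_1)
qed

definition euler_op :: "rat fps \<Rightarrow> rat fps" where
  "euler_op f = fps_X * fps_deriv f"

lemma euler_op_mult: "euler_op (f * g) = euler_op f * g + f * euler_op g"
  by (simp add: euler_op_def algebra_simps)

lemma euler_op_geom: "euler_op geom = geom_u"
  by (simp add: euler_op_def fps_deriv_geom geom_u_def)

lemma euler_op_geom_u: "euler_op geom_u = geom_u * geom_v"
proof -
  have 1: "1 = (1 - fps_X) * geom" by (simp only: geom_mult)
  have "euler_op geom_u = fps_X * geom\<^sup>2 * (1 + 2 * fps_X * geom)"
    by (simp add: euler_op_def geom_u_def fps_deriv_power fps_deriv_geom algebra_simps power2_eq_square)
  also have "1 + 2 * fps_X * geom = geom_v"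
    \<comment> \<open>Writing the summand 1 as (1 - t) \<open>geom\<close> turns 1 + 2 t
      \<open>geom\<close> into (1 + t) \<open>geom\<close>.\<close>
    by (subst 1) (simp add: geom_v_def algebra_simps)
  finally show ?thesis by (simp add: geom_u_def)
qed

lemma euler_op_geom_v: "euler_op geom_v = 2 * geom_u"
proof -
  \<comment> \<open>The factor \<open>c\<close> marks a 1 that is then replaced by (1 - t)
    \<open>geom\<close>, after which both summands are multiples of the square of
    \<open>geom\<close>.\<close>
  have "euler_op geom_v = fps_X * geom * c + fps_X * (1 + fps_X) * geom\<^sup>2" if "c = 1" for c
    by (simp add: that euler_op_def geom_v_def fps_deriv_geom algebra_simps)
  from this[OF geom_mult] show ?thesis by (simp add: geom_u_def algebra_simps power2_eq_square)
qed

lemma euler_op_okounkov_space: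
  assumes "a \<in> okounkov_space"
  shows "euler_op a \<in> okounkov_space"
proof -
  have u: "geom_u \<in> okounkov_space"
    using geom_u_power_in_okounkov_space[of 0] by simp
  have pow: "euler_op (geom_u ^ Suc m) \<in> okounkov_space" for m
  proof (induction m)
    case 0
    then show ?case
      using u geom_mult_okounkov_space(2)[of geom_u] by (simp add: euler_op_geom_u mult.commute)
  next
    case (Suc m)
    have "euler_op (geom_u ^ Suc (Suc m)) =
        geom_v * geom_u ^ Suc (Suc m) + geom_u * euler_op (geom_u ^ Suc m)"
      unfolding power_Suc[of geom_u "Suc m"] euler_op_mult by (simp add: euler_op_geom_u mult_ac)
    then show ?case
      using Suc geom_u_power_in_okounkov_space geom_mult_okounkov_space okounkov_space_add by metis
  qed
  show ?thesis
    using assms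
  proof (induction rule: okounkov_space_induct)
    case (even m)
    show ?case by (rule pow)
  next
    case (odd m)
    have "euler_op (geom_u ^ Suc m * geom_v) =
        geom_v * euler_op (geom_u ^ Suc m) + fps_const 2 * geom_u ^ Suc (Suc m)"
      by (simp add: euler_op_mult euler_op_geom_v numeral_fps_const algebra_simps)
    then show ?case
      using pow geom_u_power_in_okounkov_space geom_mult_okounkov_space
        okounkov_space_add okounkov_space_scale by metis
  qed (auto simp: okounkov_space_zero euler_op_mult euler_op_def distrib_left
        mult.left_commute[of fps_X "fps_const _"]
        intro: okounkov_space_add okounkov_space_scale)
qed

definition powers_fps :: "nat \<Rightarrow> rat fps" where
  "powers_fps k = Abs_fps (\<lambda>d. of_nat d ^ k)"

text \<open>Since 0^0 = 1, \<open>powers_fps 0\<close> is 1/(1 - t). One application of t d/dt turns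
  it into u, and all further ones stay in the space.\<close>

lemma powers_fps_in_okounkov_space: "powers_fps (Suc k) \<in> okounkov_space"
proof -
  have step: "powers_fps (Suc k) = euler_op (powers_fps k)" for k
    by (rule fps_ext) (simp add: powers_fps_def euler_op_def fps_X_mult_nth
        fps_deriv_nth of_nat_diff)
  have "powers_fps 0 = geom"
    unfolding geom_def powers_fps_def
    by (simp add: fps_inverse_one_minus_fps_X)
  then show ?thesis
    using geom_u_power_in_okounkov_space[of 0]
    by (induction k) (simp_all add: step euler_op_geom euler_op_okounkov_space)
qed

section \<open>Products of brackets of depth one\<close>

lemma fps_compose_X_power_nth:
  assumes "n > 0"
  shows "fps_nth ((f :: 'a :: comm_ring_1 fps) oo fps_X ^ n) N = (if n dvd N then fps_nth f (N div n) else 0)"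
proof -
  have "fps_nth (f oo fps_X ^ n) N = (\<Sum>i=0..N. if N = n * i then fps_nth f i else 0)"
    unfolding fps_compose_nth by (intro sum.cong) (auto simp flip: power_mult)
  also have "\<dots> = (\<Sum>i\<in>(if n dvd N then {N div n} else {}). fps_nth f i)"
    using assms by (intro sum.mono_neutral_cong_right) (auto split: if_splits)
  finally show ?thesis by simp
qed

lemma fps_compose_const_mult: "(fps_const c * f) oo g = fps_const c * (f oo g)"
  by (simp add: fps_eq_iff fps_compose_nth sum_distrib_left mult.assoc)

text \<open>The partial sums over \<open>n < N\<close> of \<open>\<Sum>\<^sub>n g(q\<^sup>n) G(n)\<close>; iterating this operator produces
  the truncations of the sums over \<open>n\<^sub>1 > \<dots> > n\<^sub>l\<close>.\<close>

definition nested_sum :: "rat fps \<Rightarrow> (nat \<Rightarrow> rat fps) \<Rightarrow> nat \<Rightarrow> rat fps" where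
  "nested_sum g G N = (\<Sum>n\<in>{1..<N}. (g oo fps_X ^ n) * G n)"

lemma nested_sum_Suc:
  "N \<ge> 1 \<Longrightarrow> nested_sum g G (Suc N) = nested_sum g G N + (g oo fps_X ^ N) * G N"
  by (simp add: nested_sum_def sum.atLeastLessThan_Suc)

text \<open>The pairs (m, n) of outer indices, m for \<open>h\<close> and n for \<open>g\<close>,
  are split into m < n, m > n and m = n. On the diagonal the product \<open>h * g\<close> appears
  because substituting q^n is multiplicative.\<close>

lemma nested_sum_quasi_shuffle:
  "nested_sum h H N * nested_sum g G N =
     nested_sum g (\<lambda>n. nested_sum h H n * G n) N +
     nested_sum h (\<lambda>n. H n * nested_sum g G n) N +
     nested_sum (h * g) (\<lambda>n. H n * G n) N"
proof (induction N)
  case (Suc N)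
  show ?case
  proof (cases "N \<ge> 1")
    case True
    then have "(h * g) oo fps_X ^ N = (h oo fps_X ^ N) * (g oo fps_X ^ N)"
      by (intro fps_compose_mult_distrib) simp
    with True Suc show ?thesis
      by (simp add: nested_sum_Suc algebra_simps)
  qed (simp add: nested_sum_def)
qed (simp add: nested_sum_def)

lemma nested_sum_add: "nested_sum g (\<lambda>n. G n + H n) = (\<lambda>N. nested_sum g G N + nested_sum g H N)"
  by (simp add: nested_sum_def fun_eq_iff distrib_left sum.distrib)

lemma nested_sum_scale: "nested_sum g (\<lambda>n. c * G n) = (\<lambda>N. c * nested_sum g G N)"
  by (simp add: nested_sum_def fun_eq_iff sum_distrib_left mult_ac)

text \<open>The linear combinations of 1 and of truncated Okounkov sums, kept as functions of the
  truncation bound: the quasi-shuffle relation involves the truncated inner sums and not just their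
  limits.\<close>

inductive_set nested_sums :: "(nat \<Rightarrow> rat fps) set" where
  one: "(\<lambda>_. 1) \<in> nested_sums"
| add: "G \<in> nested_sums \<Longrightarrow> H \<in> nested_sums \<Longrightarrow> (\<lambda>N. G N + H N) \<in> nested_sums"
| scale: "G \<in> nested_sums \<Longrightarrow> (\<lambda>N. fps_const c * G N) \<in> nested_sums"
| nested: "s \<ge> 2 \<Longrightarrow> G \<in> nested_sums \<Longrightarrow> nested_sum (okounkov_term s) G \<in> nested_sums"

text \<open>The rule \<open>nested\<close> admits only the generators
  \<open>okounkov_term s\<close>; linearity of \<open>nested_sum\<close> in its first argument
  extends it to their span.\<close>

lemma nested_sum_in_nested_sums:
  assumes "g \<in> okounkov_space" "G \<in> nested_sums"
  shows "nested_sum g G \<in> nested_sums"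
  using assms(1) unfolding okounkov_space_def
proof (induction rule: ratfps.span_induct_alt)
  case base
  \<comment> \<open>The zero function has no rule of its own and arises as the multiple of
    \<open>G\<close> by 0.\<close>
  have "nested_sum 0 G = (\<lambda>N. fps_const 0 * G N)"
    by (simp add: nested_sum_def fun_eq_iff)
  then show ?case using nested_sums.scale[OF assms(2), of 0] by simp
next
  case (step c x y)
  have "nested_sum (fps_const c * x + y) G = (\<lambda>N. fps_const c * nested_sum x G N + nested_sum y G N)"
    by (simp add: nested_sum_def fun_eq_iff fps_compose_add_distrib fps_compose_const_mult
        distrib_right sum.distrib sum_distrib_left mult.assoc)
  then show ?case using step assms(2) by (auto intro!: nested_sums.intros)
qed

text \<open>Quasi-shuffling a sum of depth one into a nested sum leaves three terms: the factor is
  pushed into the inner sum (induction hypothesis), becomes the outermost sum, or merges with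
  \<open>okounkov_term s\<close>, where closure of \<open>okounkov_space\<close> under products is
  used.\<close>

lemma nested_sums_mult:
  assumes "g \<in> okounkov_space" "G \<in> nested_sums"
  shows "(\<lambda>N. nested_sum g (\<lambda>_. 1) N * G N) \<in> nested_sums"
  using assms(2)
proof (induction rule: nested_sums.induct)
  case one
  then show ?case using assms(1) by (simp add: nested_sum_in_nested_sums nested_sums.one)
next
  case (add G H)
  then show ?case by (simp add: distrib_left nested_sums.add)
next
  case (scale G c)
  then show ?case by (simp add: mult.left_commute[of _ "fps_const _"] nested_sums.scale)
next
  case (nested s G)
  have s: "okounkov_term s \<in> okounkov_space"
    using nested(1) unfolding okounkov_space_def by (blast intro: ratfps.span_base)
  then have "g * okounkov_term s \<in> okounkov_space"
    by (intro okounkov_space_mult assms)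
  with nested s assms show ?case
    by (simp only: nested_sum_quasi_shuffle mult_1)
       (intro nested_sums.add nested_sum_in_nested_sums nested_sums.nested)
qed

section \<open>Limits in the q-adic topology\<close>

lemma tendsto_fps_add:
  fixes f g :: "'b \<Rightarrow> 'a :: group_add fps"
  shows "(f \<longlongrightarrow> a) F \<Longrightarrow> (g \<longlongrightarrow> b) F \<Longrightarrow> ((\<lambda>x. f x + g x) \<longlongrightarrow> a + b) F"
proof (rule tendsto_fpsI)
  fix n
  assume "(f \<longlongrightarrow> a) F" "(g \<longlongrightarrow> b) F"
  then have "eventually (\<lambda>x. fps_nth (f x) n = fps_nth a n) F"
      "eventually (\<lambda>x. fps_nth (g x) n = fps_nth b n) F"
    unfolding tendsto_fps_iff by blast+
  then show "eventually (\<lambda>x. fps_nth (f x + g x) n = fps_nth (a + b) n) F"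
    by eventually_elim simp
qed

lemma tendsto_fps_mult:
  fixes f g :: "'b \<Rightarrow> 'a :: ring fps"
  assumes "(f \<longlongrightarrow> a) F" "(g \<longlongrightarrow> b) F"
  shows "((\<lambda>x. f x * g x) \<longlongrightarrow> a * b) F"
proof (rule tendsto_fpsI)
  fix n
  have "eventually (\<lambda>x. \<forall>k\<in>{..n}. fps_nth (f x) k = fps_nth a k) F"
       "eventually (\<lambda>x. \<forall>k\<in>{..n}. fps_nth (g x) k = fps_nth b k) F"
    using assms unfolding tendsto_fps_iff by (simp_all add: eventually_ball_finite)
  then show "eventually (\<lambda>x. fps_nth (f x * g x) n = fps_nth (a * b) n) F"
    by eventually_elim (auto simp: fps_mult_nth intro!: sum.cong)
qed

text \<open>Terms outside \<open>B N\<close> contribute nothing below q^N, so every coefficient is a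
  finite sum and becomes stationary. This also gives summability, so that \<open>infsum\<close> is
  not the default value 0.\<close>

lemma tendsto_infsum_fps:
  fixes F :: "'b \<Rightarrow> 'a :: ab_group_add fps"
  assumes "\<And>N. finite (B N)" "\<And>N. B N \<subseteq> A"
    and "\<And>N k x. x \<in> A \<Longrightarrow> x \<notin> B N \<Longrightarrow> k < N \<Longrightarrow> fps_nth (F x) k = 0"
  shows "(\<lambda>N. \<Sum>x\<in>B N. F x) \<longlonglongrightarrow> infsum F A"
proof -
  define S where "S = Abs_fps (\<lambda>n. \<Sum>x | x \<in> A \<and> fps_nth (F x) n \<noteq> 0. fps_nth (F x) n)"
  have sub: "{x \<in> A. fps_nth (F x) n \<noteq> 0} \<subseteq> B N" if "n < N" for n N
    using assms(3) that by blast
  then have fin: "finite {x \<in> A. fps_nth (F x) n \<noteq> 0}" for n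
    using assms(1) finite_subset by blast
  have "(F has_sum S) A"
    by (rule has_sum_fpsI) (simp_all add: fin S_def)
  then have "infsum F A = S"
    by (rule infsumI)
  moreover have "(\<lambda>N. \<Sum>x\<in>B N. F x) \<longlonglongrightarrow> S"
  proof (rule tendsto_fpsI)
    fix n
    show "eventually (\<lambda>N. fps_nth (\<Sum>x\<in>B N. F x) n = fps_nth S n) sequentially"
      using eventually_gt_at_top[of n]
    proof eventually_elim
      case (elim N)
      show ?case
        unfolding S_def fps_sum_nth fps_nth_Abs_fps
        using sub[OF elim] assms(1,2) by (intro sum.mono_neutral_right) blast+
    qed
  qed
  ultimately show ?thesis by simp
qed

definition decr_lists_below :: "nat \<Rightarrow> nat \<Rightarrow> nat list set" where
  "decr_lists_below l N = {ns \<in> decr_lists l. \<forall>n\<in>set ns. n < N}"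

lemma decr_lists_below_0 [simp]: "decr_lists_below 0 N = {[]}"
  by (auto simp: decr_lists_below_def decr_lists_def)

lemma decr_lists_below_Suc:
  "decr_lists_below (Suc l) N = (\<lambda>(n, ns). n # ns) ` (SIGMA n:{1..<N}. decr_lists_below l n)"
  (is "?L = ?R")
proof
  show "?L \<subseteq> ?R"
  proof
    fix xs assume xs: "xs \<in> ?L"
    then obtain n ns where [simp]: "xs = n # ns"
      by (cases xs) (auto simp: decr_lists_below_def decr_lists_def)
    show "xs \<in> ?R"
      using xs by (auto simp: decr_lists_below_def decr_lists_def)
  qed
  show "?R \<subseteq> ?L"
    by (fastforce simp: decr_lists_below_def decr_lists_def)
qed

lemma finite_decr_lists_below: "finite (decr_lists_below l N)"
  by (induction l arbitrary: N) (auto simp: decr_lists_below_Suc)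

text \<open>The inner sum is evaluated at the outer index n, and truncation is strict, so nesting
  produces exactly the condition n_1 > n_2 > ... below \<open>N\<close>.\<close>

lemma foldr_nested_sum_one:
  "foldr (\<lambda>s. nested_sum (okounkov_term s)) ss (\<lambda>_. 1) N =
     (\<Sum>ns\<in>decr_lists_below (length ss) N. \<Prod>i<length ss. okounkov_term (ss ! i) oo fps_X ^ (ns ! i))"
proof (induction ss arbitrary: N)
  case (Cons s ss)
  have inj: "inj_on (\<lambda>(n, ns). n # ns) (SIGMA n:{1..<N}. decr_lists_below (length ss) n)"
    by (auto simp: inj_on_def)
  have "foldr (\<lambda>s. nested_sum (okounkov_term s)) (s # ss) (\<lambda>_. 1) N =
    (\<Sum>n\<in>{1..<N}. \<Sum>ns\<in>decr_lists_below (length ss) n.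
      \<Prod>i<Suc (length ss). okounkov_term ((s # ss) ! i) oo fps_X ^ ((n # ns) ! i))"
    by (simp add: nested_sum_def Cons.IH sum_distrib_left prod.lessThan_Suc_shift del: prod.lessThan_Suc)
  also have "\<dots> = (\<Sum>ns\<in>decr_lists_below (length (s # ss)) N.
      \<Prod>i<length (s # ss). okounkov_term ((s # ss) ! i) oo fps_X ^ (ns ! i))"
    unfolding length_Cons decr_lists_below_Suc sum.reindex[OF inj]
    by (subst sum.Sigma) (simp_all add: finite_decr_lists_below case_prod_unfold del: prod.lessThan_Suc)
  finally show ?case .
qed simp

lemma okounkov_term_compose:
  assumes "n > 0"
  shows "okounkov_term s oo fps_X ^ n = okounkov_Q s (fps_X ^ n) / (1 - fps_X ^ n) ^ s"
proof -
  have 0: "fps_nth (fps_X ^ n :: rat fps) 0 = 0" using assms by simp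
  have *: "((1 - fps_X) ^ s :: rat fps) oo fps_X ^ n = (1 - fps_X ^ n) ^ s"
    using 0 by (simp add: fps_compose_power[symmetric] fps_compose_sub_distrib)
  have "fps_nth ((1 - fps_X ^ n) ^ s :: rat fps) 0 = 1"
    using assms by (simp add: fps_power_zeroth power_0_left)
  then have ne: "(1 - fps_X ^ n :: rat fps) ^ s \<noteq> 0" by (metis fps_zero_nth zero_neq_one)
  have "okounkov_term s oo fps_X ^ n =
      (okounkov_Q s fps_X oo fps_X ^ n) / (((1 - fps_X) ^ s) oo fps_X ^ n)"
    unfolding okounkov_term_def
    by (rule fps_compose_divide_distrib) (use 0 ne in \<open>simp_all add: * fps_power_zeroth unit_imp_dvd\<close>)
  also have "okounkov_Q s fps_X oo fps_X ^ n = okounkov_Q s (fps_X ^ n :: rat fps)"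
    using 0 by (simp add: okounkov_Q_def fps_compose_power[symmetric] fps_compose_mult_distrib
        fps_compose_add_distrib)
  finally show ?thesis by (simp only: *)
qed

lemma okounkov_term_nth_0: "s \<ge> 2 \<Longrightarrow> fps_nth (okounkov_term s) 0 = 0"
  by (erule okounkov_term_cases) (simp_all add: geom_u_def)

lemma tendsto_okounkov_Z:
  assumes "\<forall>s\<in>set ss. s \<ge> 2"
  shows "foldr (\<lambda>s. nested_sum (okounkov_term s)) ss (\<lambda>_. 1) \<longlonglongrightarrow> okounkov_Z ss"
proof -
  let ?F = "\<lambda>ns. \<Prod>i<length ss. okounkov_term (ss ! i) oo fps_X ^ (ns ! i)"
  have "okounkov_Z ss = infsum ?F (decr_lists (length ss))"
    unfolding okounkov_Z_def
    by (intro infsum_cong prod.cong refl okounkov_term_compose[symmetric])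
       (auto simp: decr_lists_def Suc_le_eq)
  moreover have "(\<lambda>N. \<Sum>ns\<in>decr_lists_below (length ss) N. ?F ns) \<longlonglongrightarrow> infsum ?F (decr_lists (length ss))"
  proof (rule tendsto_infsum_fps)
    fix N k ns
    assume ns: "ns \<in> decr_lists (length ss)" "ns \<notin> decr_lists_below (length ss) N" and k: "k < N"
    then obtain j where j: "j < length ss" "ns ! j \<ge> N"
      by (auto simp: decr_lists_below_def decr_lists_def in_set_conv_nth)
    \<comment> \<open>This factor is a series in q^(n_j) with n_j \<ge> \<open>N\<close>, and it has
      no constant term because s_j \<ge> 2. Hence the whole product has order at least
      \<open>N\<close>.\<close>
    have "fps_nth (okounkov_term (ss ! j) oo fps_X ^ (ns ! j)) i = 0" if "i \<le> k" for i
    proof (cases "i = 0")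
      case True
      then show ?thesis using assms j by (simp add: okounkov_term_nth_0)
    next
      case False
      then have "\<not> ns ! j dvd i" using that j k by (auto dest: dvd_imp_le)
      then show ?thesis using j k by (simp add: fps_compose_X_power_nth)
    qed
    then show "fps_nth (?F ns) k = 0"
      using j(1) by (simp add: prod.remove[of "{..<length ss}" j] fps_mult_nth)
  qed (auto simp: finite_decr_lists_below, auto simp: decr_lists_below_def)
  ultimately show ?thesis by (simp add: foldr_nested_sum_one[abs_def])
qed

lemma nested_sums_tendsto_qMZV:
  assumes "G \<in> nested_sums"
  obtains L where "L \<in> qMZV" "G \<longlonglongrightarrow> L"
proof -
  let ?foldr = "foldr (\<lambda>s. nested_sum (okounkov_term s))"
  have fold_add: "?foldr ss (\<lambda>n. G n + H n) = (\<lambda>N. ?foldr ss G N + ?foldr ss H N)" for ss G H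
    by (induction ss) (simp_all add: nested_sum_add)
  have fold_scale: "?foldr ss (\<lambda>n. c * G n) = (\<lambda>N. c * ?foldr ss G N)" for ss G c
    by (induction ss) (simp_all add: nested_sum_scale)
  \<comment> \<open>A bare limit of \<open>G\<close> says nothing about the limit of \<open>nested_sum g G\<close>, so the induction has to
    carry all further nestings along.\<close>
  have "\<exists>L\<in>qMZV. ?foldr ss G \<longlonglongrightarrow> L" if "\<forall>s\<in>set ss. s \<ge> 2" for ss
    using assms that
  proof (induction arbitrary: ss rule: nested_sums.induct)
    case one
    show ?case
    proof (cases "ss = []")
      case True
      then show ?thesis by (auto simp: qMZV_def intro!: bexI[of _ 1] ratfps.span_base)
    next
      case False
      with one have "okounkov_Z ss \<in> qMZV"
        unfolding qMZV_def by (intro ratfps.span_base) blast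
      then show ?thesis using tendsto_okounkov_Z one by blast
    qed
  next
    case (add G H)
    then obtain K L where "K \<in> qMZV" "L \<in> qMZV" "?foldr ss G \<longlonglongrightarrow> K" "?foldr ss H \<longlonglongrightarrow> L"
      by meson
    then show ?case
      unfolding fold_add qMZV_def by (blast intro: ratfps.span_add tendsto_fps_add)
  next
    case (scale G c)
    then obtain L where "L \<in> qMZV" "?foldr ss G \<longlonglongrightarrow> L"
      by meson
    then show ?case
      unfolding fold_scale qMZV_def
      by (intro bexI[of _ "fps_const c * L"] ratfps.span_scale tendsto_fps_mult tendsto_const)
  next
    case (nested s G)
    \<comment> \<open>\<open>foldr\<close> applies the last entry of the list first, so the
      innermost new nesting is appended at the end.\<close>
    then show ?case using nested.IH[of "ss @ [s]"] by simp
  qed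
  from this[of "[]"] show ?thesis using that by auto
qed

text \<open>A divisor power sum over (k-1)!, indexed by the complementary divisor n, as in the
  Lambert series that it will be compared with.\<close>

lemma bracket_single_nth:
  assumes "k \<ge> 1"
  shows "fps_nth (bracket [k]) N = (\<Sum>n | n \<in> {1..N} \<and> n dvd N. of_nat (N div n) ^ (k - 1)) / fact (k - 1)"
proof -
  define F :: "nat list \<times> nat list \<Rightarrow> rat fps" where
    "F = (\<lambda>(ns, ds). fps_const (of_nat (ds ! 0) ^ (k - 1)) * fps_X ^ (ns ! 0 * ds ! 0))"
  define A where "A = decr_lists 1 \<times> pos_lists 1"
  define B where "B = (\<lambda>M. (\<lambda>(n, d). ([n], [d])) ` ({1..<M} \<times> {1..<M::nat}))"
  have A: "A = (\<lambda>(n, d). ([n], [d])) ` ({1..} \<times> {1..})"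
    by (force simp: A_def decr_lists_def pos_lists_def length_Suc_conv)
  have br: "bracket [k] = fps_const (1 / fact (k - 1)) * infsum F A"
    by (simp add: bracket_def Let_def F_def A_def)
  have "(\<lambda>M. \<Sum>x\<in>B M. F x) \<longlonglongrightarrow> infsum F A"
  proof (rule tendsto_infsum_fps)
    fix M i x assume x: "x \<in> A" "x \<notin> B M" and i: "i < M"
    then obtain n d where nd: "x = ([n], [d])" "n \<ge> 1" "d \<ge> 1"
      unfolding A by auto
    with x(2) have "M \<le> n \<or> M \<le> d"
      by (auto simp: B_def image_iff not_le)
    moreover have "n * 1 \<le> n * d" "1 * d \<le> n * d"
      using nd by (intro mult_le_mono; simp)+
    ultimately have "M \<le> n * d" by linarith
    then show "fps_nth (F x) i = 0"
      using i by (simp add: F_def nd)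
  qed (auto simp: A B_def)
  then have "eventually (\<lambda>M. fps_nth (\<Sum>x\<in>B M. F x) N = fps_nth (infsum F A) N) sequentially"
    unfolding tendsto_fps_iff by blast
  then obtain M where M: "M > N" "fps_nth (\<Sum>x\<in>B M. F x) N = fps_nth (infsum F A) N"
    using eventually_gt_at_top[of N] by (metis (mono_tags, lifting) eventually_conj eventually_happens' trivial_limit_sequentially)
  have inj: "inj_on (\<lambda>(n, d). ([n], [d])) ({1..<M} \<times> {1..<M::nat})"
    by (auto simp: inj_on_def)
  have "fps_nth (\<Sum>x\<in>B M. F x) N = (\<Sum>(n, d)\<in>{1..<M} \<times> {1..<M}. if N = n * d then of_nat d ^ (k - 1) else 0)"
    unfolding B_def sum.reindex[OF inj] fps_sum_nth
    by (intro sum.cong) (auto simp: F_def)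
  \<comment> \<open>The pairs with n d = N are given by the divisors n of N; they all lie in the box
    because \<open>M > N\<close>.\<close>
  also have "\<dots> = (\<Sum>(n, d)\<in>(\<lambda>n. (n, N div n)) ` {n \<in> {1..N}. n dvd N}. of_nat d ^ (k - 1))"
  proof (intro sum.mono_neutral_cong_right)
    show "(\<lambda>n. (n, N div n)) ` {n \<in> {1..N}. n dvd N} \<subseteq> {1..<M} \<times> {1..<M}"
      using M(1) by (auto simp: div_greater_zero_iff Suc_le_eq dvd_imp_le intro: le_less_trans[OF div_le_dividend])
  qed (auto simp: image_iff)
  also have "\<dots> = (\<Sum>n | n \<in> {1..N} \<and> n dvd N. of_nat (N div n) ^ (k - 1))"
    by (subst sum.reindex) (auto simp: inj_on_def)
  finally show ?thesis
    by (simp add: br M(2)[symmetric])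
qed

text \<open>Summing over d first exhibits [k] as a nested sum of depth one. For k \<ge> 2 the
  summand has constant term 0^(k-1) = 0; for k = 1 the constant terms would add up without
  bound.\<close>

lemma tendsto_bracket_single:
  assumes "k \<ge> 2"
  shows "nested_sum (fps_const (1 / fact (k - 1)) * powers_fps (k - 1)) (\<lambda>_. 1) \<longlonglongrightarrow> bracket [k]"
proof (rule tendsto_fpsI)
  fix N
  show "\<forall>\<^sub>F M in sequentially.
      fps_nth (nested_sum (fps_const (1 / fact (k - 1)) * powers_fps (k - 1)) (\<lambda>_. 1) M) N =
      fps_nth (bracket [k]) N"
    using eventually_gt_at_top[of N]
  proof eventually_elim
    case (elim M)
    have "(\<Sum>n\<in>{1..<M}. fps_nth (powers_fps (k - 1) oo fps_X ^ n) N) =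
        (\<Sum>n\<in>{1..<M}. if n dvd N then of_nat (N div n) ^ (k - 1) else 0)"
      by (intro sum.cong) (auto simp: fps_compose_X_power_nth powers_fps_def)
    also have "\<dots> = (\<Sum>n | n \<in> {1..N} \<and> n dvd N. of_nat (N div n) ^ (k - 1))"
      using elim assms by (intro sum.mono_neutral_cong_right) (auto simp: not_le)
    finally show ?case
      using assms by (simp add: bracket_single_nth nested_sum_def fps_sum_nth
          fps_compose_const_mult flip: sum_divide_distrib)
  qed
qed

text \<open>The product is the limit of a product of truncations. Quasi-shuffling makes the latter
  an element of \<open>nested_sums\<close>, whose limit lies in \<open>qMZV\<close>, and limits are
  unique.\<close>

lemma prod_list_bracket_single_in_qMZV:
  assumes "\<forall>k\<in>set ks. k \<ge> 2"
  shows "prod_list (map (\<lambda>k. bracket [k]) ks) \<in> qMZV"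
proof -
  have "\<exists>G\<in>nested_sums. G \<longlonglongrightarrow> prod_list (map (\<lambda>k. bracket [k]) ks)"
    using assms
  proof (induction ks)
    case Nil
    show ?case by (auto intro: nested_sums.one)
  next
    case (Cons k ks)
    then obtain G where G: "G \<in> nested_sums" "G \<longlonglongrightarrow> prod_list (map (\<lambda>k. bracket [k]) ks)"
      by auto
    have "fps_const (1 / fact (k - 1)) * powers_fps (k - 1) \<in> okounkov_space"
      using Cons.prems powers_fps_in_okounkov_space[of "k - 2"]
      by (intro okounkov_space_scale) (simp add: numeral_2_eq_2 Suc_diff_Suc)
    from nested_sums_mult[OF this G(1)] tendsto_fps_mult[OF tendsto_bracket_single[of k] G(2)] Cons.prems
    show ?case by auto
  qed
  then obtain G where G: "G \<in> nested_sums" "G \<longlonglongrightarrow> prod_list (map (\<lambda>k. bracket [k]) ks)"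
    by blast
  obtain L where "L \<in> qMZV" "G \<longlonglongrightarrow> L"
    using G(1) by (rule nested_sums_tendsto_qMZV)
  with G(2) show ?thesis using LIMSEQ_unique by blast
qed

section \<open>The Euler derivation on multivariate power series\<close>

lemma mps_coeff_0 [simp]: "mps_coeff 0 m = 0"
  by (simp add: zero_mps_def)

lemma mps_coeff_1: "mps_coeff 1 m = (if m = 0 then 1 else 0)"
  by (simp add: one_mps_def)

lemma mps_coeff_add [simp]: "mps_coeff (f + g) m = mps_coeff f m + mps_coeff g m"
  by (simp add: plus_mps_def)

lemma mps_coeff_diff [simp]: "mps_coeff (f - g) m = mps_coeff f m - mps_coeff g m"
  by (simp add: minus_mps_def)

lemma mps_coeff_uminus [simp]: "mps_coeff (- f) m = - mps_coeff f m"
  by (simp add: uminus_mps_def)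

lemma mps_coeff_mult: "mps_coeff (f * g) m = (\<Sum>(a, b) \<in> add_splits m. mps_coeff f a * mps_coeff g b)"
  by (simp add: times_mps_def)

lemma mps_coeff_sum: "mps_coeff (sum f A) m = (\<Sum>x\<in>A. mps_coeff (f x) m)"
  by (induction A rule: infinite_finite_induct) auto

lemma mps_coeff_0_mult:
  fixes f g :: "('v, 'a :: comm_ring_1) mps"
  shows "mps_coeff (f * g) 0 = mps_coeff f 0 * mps_coeff g 0"
proof -
  have "add_splits 0 = {(0 :: 'v \<Rightarrow>\<^sub>0 nat, 0 :: 'v \<Rightarrow>\<^sub>0 nat)}"
    by (auto simp: add_splits_def poly_mapping_eq_iff fun_eq_iff lookup_add)
  then show ?thesis by (simp add: mps_coeff_mult)
qed

lemma mps_coeff_0_power: "mps_coeff (f ^ n) 0 = mps_coeff f 0 ^ n"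
  by (induction n) (simp_all add: mps_coeff_0_mult mps_coeff_1)

lemma total_deg_superset:
  "finite A \<Longrightarrow> Poly_Mapping.keys m \<subseteq> A \<Longrightarrow> total_deg m = (\<Sum>v\<in>A. Poly_Mapping.lookup m v)"
  unfolding total_deg_def by (rule sum.mono_neutral_left) (auto simp: in_keys_iff)

lemma total_deg_add: "total_deg (a + b) = total_deg a + total_deg b"
proof -
  let ?A = "Poly_Mapping.keys a \<union> Poly_Mapping.keys b"
  have "total_deg (a + b) = (\<Sum>v\<in>?A. Poly_Mapping.lookup (a + b) v)"
    using keys_add[of a b] by (intro total_deg_superset) auto
  also have "\<dots> = total_deg a + total_deg b"
    by (simp add: total_deg_superset[of ?A] lookup_add sum.distrib)
  finally show ?thesis .
qed

lemma total_deg_eq_0_iff [simp]: "total_deg m = 0 \<longleftrightarrow> m = 0"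
  by (auto simp: total_deg_def in_keys_iff intro!: poly_mapping_eqI)

lemma total_deg_0 [simp]: "total_deg 0 = 0"
  by simp

lemma total_deg_single [simp]: "total_deg (Poly_Mapping.single v n) = n"
  by (cases "n = 0") (auto simp: total_deg_def)

lemma total_deg_sum: "total_deg (sum f A) = (\<Sum>x\<in>A. total_deg (f x))"
  by (induction A rule: infinite_finite_induct) (simp_all add: total_deg_add)

lemma keys_add_nat:
  fixes a b :: "'v \<Rightarrow>\<^sub>0 nat"
  shows "Poly_Mapping.keys (a + b) = Poly_Mapping.keys a \<union> Poly_Mapping.keys b"
  by (auto simp: in_keys_iff lookup_add)

text \<open>Used with two kinds of \<open>S\<close>: the monomials of a fixed degree and the
  monomials in a fixed set of variables.\<close>

definition mps_supported :: "('v \<Rightarrow>\<^sub>0 nat) set \<Rightarrow> ('v, 'a :: zero) mps \<Rightarrow> bool" where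
  "mps_supported S f \<longleftrightarrow> (\<forall>m. mps_coeff f m \<noteq> 0 \<longrightarrow> m \<in> S)"

lemma mps_supported_coeff: "mps_supported S f \<Longrightarrow> m \<notin> S \<Longrightarrow> mps_coeff f m = 0"
  by (auto simp: mps_supported_def)

lemma mps_supported_mult:
  fixes f g :: "('v, 'a :: comm_ring_1) mps"
  assumes "mps_supported S f" "mps_supported T g" "\<And>a b. a \<in> S \<Longrightarrow> b \<in> T \<Longrightarrow> a + b \<in> U"
  shows "mps_supported U (f * g)"
  unfolding mps_supported_def
proof (intro allI impI)
  fix m assume "mps_coeff (f * g) m \<noteq> 0"
  then obtain a b where "(a, b) \<in> add_splits m" "mps_coeff f a * mps_coeff g b \<noteq> 0"
    unfolding mps_coeff_mult by (metis (mono_tags, lifting) case_prod_conv sum.neutral surj_pair)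
  moreover from this have "mps_coeff f a \<noteq> 0" "mps_coeff g b \<noteq> 0"
    by auto
  ultimately show "m \<in> U"
    using assms by (auto simp: mps_supported_def add_splits_def)
qed

lemma mps_supported_diff:
  "mps_supported S f \<Longrightarrow> mps_supported S g \<Longrightarrow> mps_supported S (f - g :: ('v, 'a :: comm_ring_1) mps)"
  unfolding mps_supported_def by (metis diff_0_right mps_coeff_diff)

lemma mps_supported_sum:
  "(\<And>x. x \<in> A \<Longrightarrow> mps_supported S (f x)) \<Longrightarrow> mps_supported S (\<Sum>x\<in>A. f x :: ('v, 'a :: comm_ring_1) mps)"
  unfolding mps_supported_def mps_coeff_sum by (meson sum.neutral)

definition mps_homogeneous :: "nat \<Rightarrow> ('v, 'a :: zero) mps \<Rightarrow> bool" where
  "mps_homogeneous d = mps_supported {m. total_deg m = d}"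

lemma mps_homogeneous_coeff: "mps_homogeneous d f \<Longrightarrow> total_deg m \<noteq> d \<Longrightarrow> mps_coeff f m = 0"
  unfolding mps_homogeneous_def by (erule mps_supported_coeff) simp

lemma mps_homogeneous_power:
  "mps_homogeneous d f \<Longrightarrow> mps_homogeneous (n * d) (f ^ n :: ('v, 'a :: comm_ring_1) mps)"
proof (induction n)
  case 0
  show ?case by (auto simp: mps_homogeneous_def mps_supported_def mps_coeff_1)
next
  case (Suc n)
  then show ?case
    unfolding mps_homogeneous_def power_Suc
    by (intro mps_supported_mult[of "{m. total_deg m = d}" f "{m. total_deg m = n * d}"])
       (auto simp: total_deg_add)
qed

lemma mps_supported_keys_power:
  "mps_supported {m. Poly_Mapping.keys m \<subseteq> V} f \<Longrightarrow>
   mps_supported {m. Poly_Mapping.keys m \<subseteq> V} (f ^ n :: ('v, 'a :: comm_ring_1) mps)"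
proof (induction n)
  case 0
  show ?case by (auto simp: mps_supported_def mps_coeff_1)
next
  case (Suc n)
  then show ?case
    unfolding power_Suc
    by (intro mps_supported_mult[of "{m. Poly_Mapping.keys m \<subseteq> V}" f "{m. Poly_Mapping.keys m \<subseteq> V}"])
       (auto simp: keys_add_nat)
qed

lemma mps_homogeneous_var: "mps_homogeneous 1 (mps_var v)"
  by (auto simp: mps_homogeneous_def mps_supported_def mps_var_def split: if_splits)

lemma mps_supported_var: "v \<in> V \<Longrightarrow> mps_supported {m. Poly_Mapping.keys m \<subseteq> V} (mps_var v)"
  by (auto simp: mps_supported_def mps_var_def split: if_splits)

definition mps_euler :: "('v, 'a :: comm_ring_1) mps \<Rightarrow> ('v, 'a) mps" where
  "mps_euler f = Abs_mps (\<lambda>m. of_nat (total_deg m) * mps_coeff f m)"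

lemma mps_coeff_euler [simp]: "mps_coeff (mps_euler f) m = of_nat (total_deg m) * mps_coeff f m"
  by (simp add: mps_euler_def)

lemma mps_euler_simps [simp]:
  "mps_euler 0 = 0" "mps_euler 1 = 0" "mps_euler (f + g) = mps_euler f + mps_euler g"
  "mps_euler (f - g) = mps_euler f - mps_euler g"
  by (simp_all add: mps_eq_iff mps_coeff_1 algebra_simps)

lemma mps_euler_sum: "mps_euler (sum f A) = (\<Sum>x\<in>A. mps_euler (f x))"
  by (induction A rule: infinite_finite_induct) auto

lemma mps_euler_mult: "mps_euler (f * g) = mps_euler f * g + f * mps_euler g"
proof -
  have "of_nat (total_deg m) * (\<Sum>(a, b)\<in>add_splits m. mps_coeff f a * mps_coeff g b) =
    (\<Sum>(a, b)\<in>add_splits m. of_nat (total_deg a) * mps_coeff f a * mps_coeff g b) +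
    (\<Sum>(a, b)\<in>add_splits m. mps_coeff f a * (of_nat (total_deg b) * mps_coeff g b))" for m
    unfolding sum_distrib_left sum.distrib[symmetric]
    by (intro sum.cong) (auto simp: add_splits_def total_deg_add algebra_simps)
  then show ?thesis by (simp add: mps_eq_iff mps_coeff_mult)
qed

lemma mps_euler_power_eigen:
  assumes "mps_euler x = z * x"
  shows "mps_euler (x ^ d) = of_nat d * (z * x ^ d)"
  by (induction d) (simp_all add: mps_euler_mult assms algebra_simps)

lemma mps_coeff_of_nat_mult: "mps_coeff (of_nat d * f) m = of_nat d * mps_coeff f m"
  by (induction d) (simp_all add: algebra_simps)

text \<open>As z is linear, a coefficient of z f in degree k + 1 sees only the part of f of degree
  k, here c(k) z^k. Only lower coefficients of f are assumed known, so that the lemma applies inside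
  an induction on the degree.\<close>

lemma mps_coeff_homogeneous_mult:
  fixes z f :: "('v, 'a :: comm_ring_1) mps"
  assumes "mps_homogeneous 1 z"
    and "\<And>b. total_deg b < total_deg m \<Longrightarrow> mps_coeff f b = c (total_deg b) * mps_coeff (z ^ total_deg b) b"
  shows "mps_coeff (z * f) m =
    (if total_deg m = 0 then 0 else c (total_deg m - 1) * mps_coeff (z ^ total_deg m) m)"
proof (cases "total_deg m")
  case 0
  then show ?thesis
    using mps_homogeneous_coeff[OF assms(1), of 0] by (simp add: mps_coeff_0_mult)
next
  case (Suc k)
  have "mps_coeff (z * f) m = (\<Sum>(a, b)\<in>add_splits m. c k * (mps_coeff z a * mps_coeff (z ^ k) b))"
    unfolding mps_coeff_mult
  proof (intro sum.cong refl, clarify)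
    fix a b assume "(a, b) \<in> add_splits m"
    then have deg: "total_deg a + total_deg b = Suc k"
      using Suc by (auto simp: add_splits_def total_deg_add)
    show "mps_coeff z a * mps_coeff f b = c k * (mps_coeff z a * mps_coeff (z ^ k) b)"
    proof (cases "total_deg a = 1")
      case True
      then have "total_deg b = k" using deg by simp
      then show ?thesis using assms(2)[of b] Suc by (simp add: mult_ac)
    next
      case False
      then show ?thesis using mps_homogeneous_coeff[OF assms(1)] by simp
    qed
  qed
  also have "\<dots> = c k * mps_coeff (z * z ^ k) m"
    by (simp add: mps_coeff_mult sum_distrib_left case_prod_unfold)
  finally show ?thesis using Suc by simp
qed

section \<open>Exponentials of linear forms\<close>

lemma mps_coeff_exp:
  assumes "mps_homogeneous 1 z"
  shows "mps_coeff (mps_exp z) m = 1 / fact (total_deg m) * mps_coeff (z ^ total_deg m) m"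
proof -
  \<comment> \<open>The power z^k is homogeneous of degree k, so only k = \<open>total_deg m\<close>
    survives.\<close>
  have "mps_coeff (mps_exp z) m =
      (\<Sum>k\<in>{total_deg m}. fps_nth (fps_exp 1) k * mps_coeff (z ^ k) m)"
    unfolding mps_exp_def mps_compose_def mps_coeff_Abs
    using mps_homogeneous_coeff[OF mps_homogeneous_power[OF assms]]
    by (intro sum.mono_neutral_right) auto
  then show ?thesis by simp
qed

lemma mps_euler_exp:
  fixes z :: "('v, 'a :: field_char_0) mps"
  assumes "mps_homogeneous 1 z"
  shows "mps_euler (mps_exp z) = z * mps_exp z"
  unfolding mps_eq_iff
proof
  fix m :: "'v \<Rightarrow>\<^sub>0 nat"
  have "fact (total_deg m) = of_nat (total_deg m) * (fact (total_deg m - 1) :: 'a)" if "m \<noteq> 0"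
    using that by (intro fact_reduce) (simp add: zero_less_iff_neq_zero)
  then show "mps_coeff (mps_euler (mps_exp z)) m = mps_coeff (z * mps_exp z) m"
    using mps_coeff_homogeneous_mult[OF assms, of m "mps_exp z" "\<lambda>n. 1 / fact n"]
    by (simp add: mps_coeff_exp[OF assms])
qed

text \<open>These are the coefficients of exp(d z). No addition law is used: y = exp(z)^d satisfies
  D y = d z y for the Euler derivation D, which determines y degree by degree from its constant term
  1.\<close>

lemma mps_coeff_exp_power:
  fixes z :: "('v, 'a :: field_char_0) mps"
  assumes "mps_homogeneous 1 z"
  shows "mps_coeff (mps_exp z ^ d) m =
    of_nat d ^ total_deg m / fact (total_deg m) * mps_coeff (z ^ total_deg m) m"
proof (induction "total_deg m" arbitrary: m rule: less_induct)
  case less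
  show ?case
  proof (cases "m = 0")
    case True
    then show ?thesis
      by (simp add: mps_coeff_0_power mps_coeff_exp[OF assms] mps_coeff_1 total_deg_def)
  next
    case False
    then obtain k where k: "total_deg m = Suc k"
      using total_deg_eq_0_iff not0_implies_Suc by blast
    have "of_nat (Suc k) * mps_coeff (mps_exp z ^ d) m = mps_coeff (mps_euler (mps_exp z ^ d)) m"
      by (simp add: k)
    also have "\<dots> = of_nat d * (of_nat d ^ k / fact k * mps_coeff (z ^ Suc k) m)"
      using mps_coeff_homogeneous_mult[OF assms, of m "mps_exp z ^ d" "\<lambda>n. of_nat d ^ n / fact n"] less k
      by (simp add: mps_euler_power_eigen[OF mps_euler_exp[OF assms]] mps_coeff_of_nat_mult)
    also have "\<dots> = of_nat (Suc k) * (of_nat d ^ Suc k / fact (Suc k) * mps_coeff (z ^ Suc k) m)"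
      by (simp del: of_nat_Suc add: fact_Suc)
    finally show ?thesis
      unfolding k by (subst (asm) mult_cancel_left) (simp del: of_nat_Suc power_Suc fact_Suc)
  qed
qed

text \<open>The extra factor z shifts exponent and factorial by one, which produces the
  d^(k-1)/(k-1)! of the bracket [k] in degree k.\<close>

lemma mps_coeff_mult_exp_power:
  fixes z :: "('v, 'a :: field_char_0) mps"
  assumes "mps_homogeneous 1 z"
  shows "mps_coeff (z * mps_exp z ^ d) m = (if m = 0 then 0 else
    of_nat d ^ (total_deg m - 1) / fact (total_deg m - 1) * mps_coeff (z ^ total_deg m) m)"
  using mps_coeff_homogeneous_mult[OF assms, of m "mps_exp z ^ d" "\<lambda>n. of_nat d ^ n / fact n"]
  by (simp add: mps_coeff_exp_power[OF assms])

section \<open>The logarithmic derivative of the infinite products\<close>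

definition fps_euler :: "('v, 'a :: comm_ring_1) mps fps \<Rightarrow> ('v, 'a) mps fps" where
  "fps_euler F = Abs_fps (\<lambda>n. mps_euler (fps_nth F n))"

lemma fps_nth_fps_euler [simp]: "fps_nth (fps_euler F) n = mps_euler (fps_nth F n)"
  by (simp add: fps_euler_def)

lemma fps_euler_mult: "fps_euler (F * G) = fps_euler F * G + F * fps_euler G"
  by (simp add: fps_eq_iff fps_mult_nth mps_euler_sum mps_euler_mult sum.distrib)

lemma fps_euler_1 [simp]: "fps_euler 1 = 0"
  by (simp add: fps_eq_iff fps_one_nth)

text \<open>Logarithmic derivatives add up. They are written as cofactors \<open>g j\<close>, so
  that nothing has to be divided.\<close>

lemma fps_euler_prod:
  assumes "finite A" "\<And>j. j \<in> A \<Longrightarrow> fps_euler (f j) = f j * g j"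
  shows "fps_euler (\<Prod>j\<in>A. f j) = (\<Prod>j\<in>A. f j) * (\<Sum>j\<in>A. g j)"
  using assms by (induction A rule: finite_induct) (simp_all add: fps_euler_mult algebra_simps)

lemma tendsto_fps_euler: "(f \<longlongrightarrow> L) F \<Longrightarrow> ((\<lambda>n. fps_euler (f n)) \<longlongrightarrow> fps_euler L) F"
  unfolding tendsto_fps_iff
proof
  fix n
  assume "\<forall>n. \<forall>\<^sub>F x in F. fps_nth (f x) n = fps_nth L n"
  then show "\<forall>\<^sub>F x in F. fps_nth (fps_euler (f x)) n = fps_nth (fps_euler L) n"
    by (rule allE[of _ n]) (auto elim: eventually_mono)
qed

text \<open>Factor i changes coefficients only from q^(i+1) on, so the coefficient of q^k is settled
  by the partial product up to k.\<close>

lemma qpoch_inf_tendsto: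
  fixes x :: "'a :: comm_ring_1"
  shows "(\<lambda>n. \<Prod>i\<le>n. 1 - fps_const x * fps_X * fps_X ^ i) \<longlonglongrightarrow> qpoch_inf (fps_const x * fps_X)"
    and "fps_nth (qpoch_inf (fps_const x * fps_X)) 0 = 1"
proof -
  define f where "f = (\<lambda>i. 1 - fps_const x * fps_X * fps_X ^ i)"
  define P where "P = (\<lambda>n. \<Prod>i\<le>n. f i)"
  define S where "S = Abs_fps (\<lambda>k. fps_nth (P k) k)"
  have f: "f i = 1 - fps_const x * fps_X ^ Suc i" for i
    by (simp add: f_def mult.assoc)
  have f0: "fps_nth (f i) 0 = 1" for i
    by (simp add: f)
  have stable: "fps_nth (P n) k = fps_nth (P k) k" if "k \<le> n" for n k
    using that
  proof (induction n rule: dec_induct)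
    case (step n)
    have "P (Suc n) = P n - fps_const x * (fps_X ^ Suc (Suc n) * P n)"
      by (simp add: P_def f algebra_simps)
    then have "fps_nth (P (Suc n)) k = fps_nth (P n) k"
      using step(1) by (simp only: fps_sub_nth fps_mult_left_const_nth fps_X_power_mult_nth) simp
    then show ?case using step by simp
  qed simp
  have lim: "P \<longlonglongrightarrow> S"
  proof (rule tendsto_fpsI)
    fix k
    show "\<forall>\<^sub>F n in sequentially. fps_nth (P n) k = fps_nth S k"
      using eventually_ge_at_top[of k]
      by eventually_elim (unfold S_def fps_nth_Abs_fps, rule stable)
  qed
  have S0: "fps_nth S 0 = 1"
    by (simp add: S_def P_def f0)
  \<comment> \<open>Without a zero factor, \<open>has_prod\<close> amounts to convergence of the
    partial products to a nonzero limit; constant term 1 makes the limit nonzero.\<close>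
  have "f i \<noteq> 0" for i
    using f0[of i] by force
  then have "f has_prod p \<longleftrightarrow> P \<longlonglongrightarrow> p \<and> p \<noteq> 0" for p
    by (simp add: has_prod_def raw_has_prod_def P_def)
  moreover have "S \<noteq> 0" using S0 by force
  ultimately have "prodinf f = S"
    unfolding prodinf_def using lim LIMSEQ_unique by (intro the_equality) blast+
  then have "qpoch_inf (fps_const x * fps_X) = S"
    by (simp add: qpoch_inf_def f_def)
  then show "(\<lambda>n. \<Prod>i\<le>n. 1 - fps_const x * fps_X * fps_X ^ i) \<longlonglongrightarrow> qpoch_inf (fps_const x * fps_X)"
    and "fps_nth (qpoch_inf (fps_const x * fps_X)) 0 = 1"
    using lim S0 by (simp_all add: P_def f_def)
qed

text \<open>The sum of z x^d q^(n d) over n, d \<ge> 1. The terms with a given n stem from the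
  factor 1 - x q^n.\<close>

definition lambert_series :: "'a :: comm_ring_1 \<Rightarrow> 'a \<Rightarrow> 'a fps" where
  "lambert_series z x = Abs_fps (\<lambda>N. \<Sum>n | n \<in> {1..N} \<and> n dvd N. z * x ^ (N div n))"

lemma fps_euler_qpoch_inf:
  assumes "mps_euler x = z * x"
  shows "fps_euler (qpoch_inf (fps_const x * fps_X)) =
    qpoch_inf (fps_const x * fps_X) * - lambert_series z x"
proof -
  define f where "f = (\<lambda>i. 1 - fps_const x * fps_X * fps_X ^ i)"
  \<comment> \<open>\<open>E i\<close> is the geometric series 1/(1 - x q^(i+1)). Since
    D(\<open>f i\<close>) = z (\<open>f i\<close> - 1), the logarithmic derivative of
    \<open>f i\<close> is z (1 - \<open>E i\<close>), that is \<open>g i\<close>.\<close>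
  define E where "E = (\<lambda>i. Abs_fps (\<lambda>N. if Suc i dvd N then x ^ (N div Suc i) else 0))"
  define g where "g = (\<lambda>i. fps_const z * (1 - E i))"
  have f: "f i = 1 - fps_const x * fps_X ^ Suc i" for i
    by (simp add: f_def mult.assoc)
  have E: "fps_const x * fps_X ^ Suc i * E i = E i - 1" for i
  proof (rule fps_ext)
    fix N
    have "fps_nth (fps_const x * fps_X ^ Suc i * E i) N =
        (if N < Suc i then 0 else x * fps_nth (E i) (N - Suc i))"
      by (simp only: mult.assoc fps_mult_left_const_nth fps_X_power_mult_nth) simp
    also have "\<dots> = fps_nth (E i - 1) N"
    proof (cases "N < Suc i")
      case True
      then show ?thesis by (auto simp: E_def dest: dvd_imp_le)
    next
      case False
      then obtain M where "N = Suc i + M" by (metis le_add_diff_inverse not_less)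
      then show ?thesis by (simp add: E_def power_add del: add_Suc)
    qed
    finally show "fps_nth (fps_const x * fps_X ^ Suc i * E i) N = fps_nth (E i - 1) N" .
  qed
  have fE: "f i * E i = 1" for i
    unfolding f by (simp only: left_diff_distrib E) simp
  have euler_f: "fps_euler (f i) = f i * g i" for i
  proof -
    have "f i * g i = fps_const z * (f i - f i * E i)"
      by (simp add: g_def algebra_simps)
    also have "\<dots> = fps_const z * (f i - 1)" by (simp only: fE)
    also have "\<dots> = - (fps_const (z * x) * fps_X ^ Suc i)"
      by (simp add: f algebra_simps flip: fps_const_mult)
    also have "\<dots> = fps_euler (f i)"
      unfolding f by (rule fps_ext) (simp add: assms fps_one_nth if_distrib[of mps_euler] del: power_Suc)
    finally show ?thesis ..
  qed
  have "(\<lambda>n. \<Sum>i\<le>n. g i) \<longlonglongrightarrow> - lambert_series z x"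
  proof (rule tendsto_fpsI)
    fix N
    show "\<forall>\<^sub>F n in sequentially. fps_nth (\<Sum>i\<le>n. g i) N = fps_nth (- lambert_series z x) N"
      using eventually_ge_at_top[of N]
    proof eventually_elim
      case (elim n)
      have "(\<Sum>i\<le>n. fps_nth (g i) N) = (\<Sum>i\<le>n. if Suc i dvd N \<and> N \<noteq> 0 then - (z * x ^ (N div Suc i)) else 0)"
        by (intro sum.cong) (auto simp: g_def E_def fps_one_nth)
      also have "\<dots> = (\<Sum>i | Suc i \<in> {1..N} \<and> Suc i dvd N. - (z * x ^ (N div Suc i)))"
        using elim by (intro sum.mono_neutral_cong_right) (auto dest: dvd_imp_le)
      also have "\<dots> = (\<Sum>i | i \<in> {1..N} \<and> i dvd N. - (z * x ^ (N div i)))"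
        by (rule sum.reindex_bij_witness[of _ "\<lambda>i. i - 1" Suc]) auto
      finally show ?case by (simp add: fps_sum_nth lambert_series_def sum_negf)
    qed
  qed
  with qpoch_inf_tendsto(1)[of x]
  have "(\<lambda>n. (\<Prod>i\<le>n. f i) * (\<Sum>i\<le>n. g i)) \<longlonglongrightarrow> qpoch_inf (fps_const x * fps_X) * - lambert_series z x"
    unfolding f_def by (rule tendsto_fps_mult)
  moreover have "(\<lambda>n. fps_euler (\<Prod>i\<le>n. f i)) \<longlonglongrightarrow> fps_euler (qpoch_inf (fps_const x * fps_X))"
    unfolding f_def by (intro tendsto_fps_euler qpoch_inf_tendsto)
  moreover have "fps_euler (\<Prod>i\<le>n. f i) = (\<Prod>i\<le>n. f i) * (\<Sum>i\<le>n. g i)" for n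
    by (intro fps_euler_prod euler_f) auto
  ultimately show ?thesis
    using LIMSEQ_unique by simp
qed

section \<open>Exchanging the roles of q and the other variables\<close>

lemma mps_of_fps_coeff: "mps_coeff (mps_of_fps F) m = Abs_fps (\<lambda>N. mps_coeff (fps_nth F N) m)"
  by (simp add: mps_of_fps_def)

lemma mps_of_fps_mult:
  "mps_of_fps (F * G :: ('v, 'a :: comm_ring_1) mps fps) = mps_of_fps F * mps_of_fps G"
proof -
  have "(\<Sum>i=0..N. \<Sum>(a, b)\<in>add_splits m. mps_coeff (fps_nth F i) a * mps_coeff (fps_nth G (N - i)) b) =
    (\<Sum>(a, b)\<in>add_splits m. \<Sum>i=0..N. mps_coeff (fps_nth F i) a * mps_coeff (fps_nth G (N - i)) b)" for m N
    unfolding case_prod_unfold by (rule sum.swap)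
  then show ?thesis
    by (simp add: mps_eq_iff fps_eq_iff mps_of_fps_coeff mps_coeff_mult fps_mult_nth fps_sum_nth
        mps_coeff_sum case_prod_unfold)
qed

lemma mps_of_fps_1: "mps_of_fps (1 :: ('v, 'a :: comm_ring_1) mps fps) = 1"
  by (auto simp: mps_eq_iff fps_eq_iff mps_of_fps_coeff mps_coeff_1 fps_one_nth)

lemma mps_of_fps_coeff_0_mult:
  "mps_coeff (mps_of_fps (F * G :: ('v, 'a :: comm_ring_1) mps fps)) 0 =
   mps_coeff (mps_of_fps F) 0 * mps_coeff (mps_of_fps G) 0"
  by (simp add: mps_of_fps_mult mps_coeff_0_mult)

lemma mps_of_fps_coeff_0_prod:
  "mps_coeff (mps_of_fps (\<Prod>j\<in>A. F j :: ('v, 'a :: comm_ring_1) mps fps)) 0 =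
   (\<Prod>j\<in>A. mps_coeff (mps_of_fps (F j)) 0)"
  by (induction A rule: infinite_finite_induct)
     (simp_all add: mps_of_fps_coeff_0_mult mps_of_fps_1 mps_coeff_1)

text \<open>Taking constant terms is multiplicative and respects q-adic limits, so x may be replaced
  by its constant term 1. The value does not depend on x, hence numerators and denominators will
  cancel.\<close>

lemma mps_of_fps_coeff_0_qpoch_inf:
  fixes x :: "('v, 'a :: comm_ring_1) mps"
  assumes "mps_coeff x 0 = 1"
  shows "mps_coeff (mps_of_fps (qpoch_inf (fps_const x * fps_X))) 0 = qpoch_inf (fps_const 1 * fps_X)"
proof -
  define c where "c = (\<lambda>F :: ('v, 'a) mps fps. mps_coeff (mps_of_fps F) 0)"
  have "c (1 - fps_const x * fps_X * fps_X ^ i) = 1 - fps_const 1 * fps_X * fps_X ^ i" for i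
    by (rule fps_ext) (simp add: c_def mps_of_fps_coeff mult.assoc fps_one_nth mps_coeff_1 assms
        flip: power_Suc del: fps_const_1_eq_1)
  then have "c (\<Prod>i\<le>n. 1 - fps_const x * fps_X * fps_X ^ i) =
      (\<Prod>i\<le>n. 1 - fps_const 1 * fps_X * fps_X ^ i)" for n
    unfolding c_def mps_of_fps_coeff_0_prod by simp
  moreover have "(\<lambda>n. c (\<Prod>i\<le>n. 1 - fps_const x * fps_X * fps_X ^ i)) \<longlonglongrightarrow> c (qpoch_inf (fps_const x * fps_X))"
  proof (rule tendsto_fpsI)
    fix k
    have "\<forall>\<^sub>F n in sequentially. fps_nth (\<Prod>i\<le>n. 1 - fps_const x * fps_X * fps_X ^ i) k =
        fps_nth (qpoch_inf (fps_const x * fps_X)) k"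
      using qpoch_inf_tendsto(1)[of x] unfolding tendsto_fps_iff by blast
    then show "\<forall>\<^sub>F n in sequentially. fps_nth (c (\<Prod>i\<le>n. 1 - fps_const x * fps_X * fps_X ^ i)) k =
        fps_nth (c (qpoch_inf (fps_const x * fps_X))) k"
      by eventually_elim (simp add: c_def mps_of_fps_coeff)
  qed
  ultimately have "(\<lambda>n. \<Prod>i\<le>n. 1 - fps_const 1 * fps_X * fps_X ^ i) \<longlonglongrightarrow> c (qpoch_inf (fps_const x * fps_X))"
    by simp
  from LIMSEQ_unique[OF this qpoch_inf_tendsto(1)] show ?thesis
    unfolding c_def .
qed

text \<open>Division of q-series goes through the partial inverse of a leading coefficient. For
  constant term 1 that inverse is 1, and \<open>/\<close> is genuine division.\<close>

lemma fps_mult_inverse_mps: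
  fixes Q :: "('v, 'a :: comm_ring_1) mps fps"
  assumes "fps_nth Q 0 = 1"
  shows "Q * inverse Q = 1" and "F / Q = F * inverse Q"
proof -
  show "Q * inverse Q = 1"
    unfolding fps_inverse_def using assms by (intro fps_right_inverse) simp
  show "F / Q = F * inverse Q"
    using assms by (intro fps_divide_unit) simp
qed

text \<open>Differentiating \<open>Q * inverse Q = 1\<close> shows that \<open>inverse Q\<close> has
  logarithmic derivative -g.\<close>

lemma fps_euler_divide:
  fixes P Q :: "('v, 'a :: comm_ring_1) mps fps"
  assumes "fps_nth Q 0 = 1" "fps_euler P = P * f" "fps_euler Q = Q * g"
  shows "fps_euler (P / Q) = P / Q * (f - g)"
proof -
  note inv = fps_mult_inverse_mps[OF assms(1)]
  have "0 = inverse Q * fps_euler (Q * inverse Q)"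
    by (simp add: inv(1))
  also have "\<dots> = (Q * inverse Q) * (g * inverse Q + fps_euler (inverse Q))"
    by (simp add: fps_euler_mult assms algebra_simps)
  finally have "fps_euler (inverse Q) = - (inverse Q * g)"
    by (simp add: inv(1) eq_neg_iff_add_eq_0 algebra_simps)
  then show ?thesis
    by (simp add: inv(2) fps_euler_mult assms algebra_simps)
qed

section \<open>The coefficients of the product\<close>

definition single_bracket_products :: "nat \<Rightarrow> rat fps set" where
  "single_bracket_products k =
     {prod_list (map (\<lambda>k. bracket [k]) ks) | ks. (\<forall>k\<in>set ks. k \<ge> 2) \<and> sum_list ks = k}"

lemma span_single_bracket_products_mult:
  assumes "f \<in> ratfps.span (single_bracket_products k)" "l \<ge> 2"
  shows "f * (fps_const c * bracket [l]) \<in> ratfps.span (single_bracket_products (k + l))"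
proof -
  have "f * bracket [l] \<in> ratfps.span (single_bracket_products (k + l))"
    using assms(1)
  proof (induction rule: ratfps.span_induct_alt)
    case base
    show ?case by (simp add: ratfps.span_zero)
  next
    case (step c x y)
    then obtain ks where "x = prod_list (map (\<lambda>k. bracket [k]) ks)" "\<forall>k\<in>set ks. k \<ge> 2" "sum_list ks = k"
      by (auto simp: single_bracket_products_def)
    then have "x * bracket [l] \<in> single_bracket_products (k + l)"
      unfolding single_bracket_products_def using assms(2)
      by (intro CollectI exI[of _ "l # ks"]) (simp add: mult.commute)
    with step show ?case
      by (simp add: distrib_right mult.assoc ratfps.span_add ratfps.span_scale ratfps.span_base)
  qed
  from ratfps.span_scale[OF this, of c] show ?thesis
    by (simp add: mult.left_commute)
qed

lemma span_single_bracket_products_has_weight: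
  assumes "f \<in> ratfps.span (single_bracket_products k)"
  shows "has_weight f k"
proof -
  have "single_bracket_products k \<subseteq> qMZV"
    by (auto simp: single_bracket_products_def intro: prod_list_bracket_single_in_qMZV)
  then have "ratfps.span (single_bracket_products k) \<subseteq> qMZV"
    unfolding qMZV_def by (rule ratfps.span_minimal[OF _ ratfps.subspace_span])
  moreover have "single_bracket_products k \<subseteq> bracket_products k"
  proof
    fix x assume "x \<in> single_bracket_products k"
    then obtain ks where ks: "x = prod_list (map (\<lambda>k. bracket [k]) ks)" "\<forall>k\<in>set ks. k \<ge> 2" "sum_list ks = k"
      by (auto simp: single_bracket_products_def)
    then show "x \<in> bracket_products k"
      unfolding bracket_products_def
      by (intro CollectI exI[of _ "map (\<lambda>k. [k]) ks"]) (auto simp: o_def)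
  qed
  then have "ratfps.span (single_bracket_products k) \<subseteq> ratfps.span (bracket_products k)"
    by (rule ratfps.span_mono)
  ultimately show ?thesis
    using assms by (auto simp: has_weight_def)
qed

text \<open>The series is the sum of [k] z^k over k \<ge> 1: the part of z exp(z)^d of degree k is
  d^(k-1)/(k-1)! z^k, and summing over n d = N gives the coefficient of q^N in [k].\<close>

lemma mps_of_fps_lambert_series_exp:
  assumes "mps_homogeneous 1 z"
  shows "mps_coeff (mps_of_fps (lambert_series z (mps_exp z))) m =
    (if m = 0 then 0 else fps_const (mps_coeff (z ^ total_deg m) m) * bracket [total_deg m])"
proof (rule fps_ext)
  fix N
  show "fps_nth (mps_coeff (mps_of_fps (lambert_series z (mps_exp z))) m) N =
    fps_nth (if m = 0 then 0 else fps_const (mps_coeff (z ^ total_deg m) m) * bracket [total_deg m]) N"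
  proof (cases "m = 0")
    case False
    then have "total_deg m \<ge> 1"
      by (metis One_nat_def Suc_leI gr0I total_deg_eq_0_iff)
    from bracket_single_nth[OF this] show ?thesis
      using False
      by (simp add: mps_of_fps_coeff lambert_series_def mps_coeff_sum
          mps_coeff_mult_exp_power[OF assms] sum_distrib_left sum_divide_distrib mult_ac)
  qed (simp add: mps_of_fps_coeff lambert_series_def mps_coeff_sum mps_coeff_mult_exp_power[OF assms])
qed

lemma mps_of_fps_sum: "mps_of_fps (\<Sum>j\<in>A. F j) = (\<Sum>j\<in>A. mps_of_fps (F j))"
  by (simp add: mps_eq_iff fps_eq_iff mps_of_fps_coeff mps_coeff_sum fps_sum_nth)

lemma mps_of_fps_diff: "mps_of_fps (F - G) = mps_of_fps F - mps_of_fps G"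
  by (simp add: mps_eq_iff fps_eq_iff mps_of_fps_coeff)

lemma mps_of_fps_euler: "mps_of_fps (fps_euler F) = mps_euler (mps_of_fps F)"
  by (simp add: mps_eq_iff fps_eq_iff mps_of_fps_coeff fps_of_nat[symmetric])

text \<open>Formulated for arbitrary linear forms with equal sums, so that the dependent form w_r
  needs no separate treatment. All three claims rest on D F = F H with H the logarithmic
  derivative.\<close>

lemma qpoch_ratio_coeffs:
  fixes z w :: "nat \<Rightarrow> ('v, rat) mps" and V :: "'v set"
  assumes F_def: "F = mps_of_fps (\<Prod>j=1..r. qpoch_inf (fps_const (mps_exp (z j)) * fps_X) /
                                    qpoch_inf (fps_const (mps_exp (w j)) * fps_X))"
    and z: "\<And>j. j \<in> {1..r} \<Longrightarrow> mps_homogeneous 1 (z j)"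
    and w: "\<And>j. j \<in> {1..r} \<Longrightarrow> mps_homogeneous 1 (w j)"
    and z_supp: "\<And>j. j \<in> {1..r} \<Longrightarrow> mps_supported {m. Poly_Mapping.keys m \<subseteq> V} (z j)"
    and w_supp: "\<And>j. j \<in> {1..r} \<Longrightarrow> mps_supported {m. Poly_Mapping.keys m \<subseteq> V} (w j)"
    and balanced: "(\<Sum>j=1..r. z j) = (\<Sum>j=1..r. w j)"
  shows "mps_coeff F 0 = 1"
    and "mps_coeff F m \<in> ratfps.span (single_bracket_products (total_deg m))"
    and "\<not> Poly_Mapping.keys m \<subseteq> V \<Longrightarrow> mps_coeff F m = 0"
proof -
  let ?q = "\<lambda>z. qpoch_inf (fps_const (mps_exp z) * fps_X)"
  define \<Phi> where "\<Phi> = (\<Prod>j=1..r. ?q (z j) / ?q (w j))"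
  define H where "H = (\<Sum>j=1..r. - lambert_series (z j) (mps_exp (z j)) - - lambert_series (w j) (mps_exp (w j)))"
  \<comment> \<open>The coefficient at b of the difference of power sums of the w_j and z_j, with
    exponent the degree of b.\<close>
  define c where "c = (\<lambda>b. \<Sum>j=1..r. mps_coeff (w j ^ total_deg b) b - mps_coeff (z j ^ total_deg b) b)"
  have F: "F = mps_of_fps \<Phi>"
    by (simp add: F_def \<Phi>_def)

  show F0: "mps_coeff F 0 = 1"
    unfolding F \<Phi>_def mps_of_fps_coeff_0_prod
  proof (intro prod.neutral ballI)
    fix j assume j: "j \<in> {1..r}"
    have exp0: "mps_coeff (mps_exp u) 0 = 1" if "mps_homogeneous 1 u" for u :: "('v, rat) mps"
      using mps_coeff_exp[OF that, of 0] by (simp add: mps_coeff_1)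
    let ?Q = "?q (w j)"
    note inv = fps_mult_inverse_mps[OF qpoch_inf_tendsto(2)[of "mps_exp (w j)"]]
    \<comment> \<open>Numerator and denominator have the same constant term in the variables, so the
      numerator may be exchanged for \<open>?Q\<close>.\<close>
    have "mps_coeff (mps_of_fps (?q (z j) / ?Q)) 0 = mps_coeff (mps_of_fps (?Q * inverse ?Q)) 0"
      unfolding inv(2) mps_of_fps_coeff_0_mult
      by (simp only: mps_of_fps_coeff_0_qpoch_inf[OF exp0[OF z[OF j]]]
          mps_of_fps_coeff_0_qpoch_inf[OF exp0[OF w[OF j]]])
    then show "mps_coeff (mps_of_fps (?q (z j) / ?Q)) 0 = 1"
      by (simp add: inv(1) mps_of_fps_1 mps_coeff_1)
  qed

  have "fps_euler \<Phi> = \<Phi> * H"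
    unfolding \<Phi>_def H_def
    by (intro fps_euler_prod fps_euler_divide fps_euler_qpoch_inf mps_euler_exp z w qpoch_inf_tendsto) auto
  then have euler: "mps_euler F = F * mps_of_fps H"
    by (simp add: F flip: mps_of_fps_euler mps_of_fps_mult)
  have H: "mps_coeff (mps_of_fps H) b = (if b = 0 then 0 else fps_const (c b) * bracket [total_deg b])" for b
  proof -
    have "mps_of_fps H = (\<Sum>j=1..r. mps_of_fps (lambert_series (w j) (mps_exp (w j))) -
        mps_of_fps (lambert_series (z j) (mps_exp (z j))))"
      by (simp add: H_def mps_of_fps_sum mps_of_fps_diff)
    then have "mps_coeff (mps_of_fps H) b = (\<Sum>j=1..r. if b = 0 then 0 else
        fps_const (mps_coeff (w j ^ total_deg b) b) * bracket [total_deg b] -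
        fps_const (mps_coeff (z j ^ total_deg b) b) * bracket [total_deg b])"
      unfolding mps_coeff_sum
      by (simp only: mps_coeff_sum mps_coeff_diff mps_of_fps_lambert_series_exp[OF z]
          mps_of_fps_lambert_series_exp[OF w] cong: sum.cong) (cases "b = 0"; simp)
    also have "\<dots> = (if b = 0 then 0 else fps_const (c b) * bracket [total_deg b])"
      by (cases "b = 0"; rule fps_ext) (simp_all add: fps_sum_nth c_def sum_distrib_right left_diff_distrib)
    finally show ?thesis .
  qed
  \<comment> \<open>Here the equality of the two sums enters: it removes [1], which is not an
    admissible factor.\<close>
  have c1: "c b = 0" if "total_deg b = 1" for b
  proof -
    have "c b = mps_coeff (\<Sum>j=1..r. w j) b - mps_coeff (\<Sum>j=1..r. z j) b"
      using that by (simp add: c_def mps_coeff_sum sum_subtractf)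
    then show ?thesis by (simp only: balanced diff_self)
  qed
  have cV: "c b = 0" if "\<not> Poly_Mapping.keys b \<subseteq> V" for b
    unfolding c_def
  proof (intro sum.neutral ballI)
    fix j assume j: "j \<in> {1..r}"
    have "mps_coeff (z j ^ total_deg b) b = 0" "mps_coeff (w j ^ total_deg b) b = 0"
      by (rule mps_supported_coeff[OF mps_supported_keys_power[OF z_supp[OF j]]], simp add: that,
          rule mps_supported_coeff[OF mps_supported_keys_power[OF w_supp[OF j]]], simp add: that)
    then show "mps_coeff (w j ^ total_deg b) b - mps_coeff (z j ^ total_deg b) b = 0"
      by simp
  qed
  \<comment> \<open>Coefficients at m are compared in D F = F H and divided by the degree. As H has
    no constant term, only coefficients of F of lower degree contribute.\<close>
  have rec: "mps_coeff F m = fps_const (1 / of_nat (total_deg m)) *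
      (\<Sum>(a, b)\<in>add_splits m. mps_coeff F a * mps_coeff (mps_of_fps H) b)" if "m \<noteq> 0" for m
  proof -
    have "(\<Sum>(a, b)\<in>add_splits m. mps_coeff F a * mps_coeff (mps_of_fps H) b) =
        fps_const (of_nat (total_deg m)) * mps_coeff F m"
      using mps_coeff_euler[of F m] unfolding euler mps_coeff_mult by (simp add: fps_of_nat)
    then show ?thesis
      using that by (simp add: mult.assoc[symmetric])
  qed

  show "mps_coeff F m \<in> ratfps.span (single_bracket_products (total_deg m))"
  proof (induction "total_deg m" arbitrary: m rule: less_induct)
    case less
    show ?case
    proof (cases "m = 0")
      case True
      then show ?thesis
        by (auto simp: F0 single_bracket_products_def intro!: ratfps.span_base exI[of _ "[]"])
    next
      case False
      have "mps_coeff F a * mps_coeff (mps_of_fps H) b \<in> ratfps.span (single_bracket_products (total_deg m))"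
        if "(a, b) \<in> add_splits m" for a b
      proof (cases "total_deg b \<ge> 2")
        case True
        have deg: "total_deg m = total_deg a + total_deg b"
          using that by (simp add: add_splits_def flip: total_deg_add)
        then have "mps_coeff F a \<in> ratfps.span (single_bracket_products (total_deg a))"
          using True by (intro less) simp
        from span_single_bracket_products_mult[OF this True] True show ?thesis
          by (auto simp: H deg)
      next
        case False
        then have "total_deg b = 0 \<or> total_deg b = 1" by linarith
        then have "mps_coeff (mps_of_fps H) b = 0"
          using c1 by (auto simp: H)
        then show ?thesis by (simp add: ratfps.span_zero)
      qed
      then show ?thesis
        unfolding rec[OF False] by (intro ratfps.span_scale ratfps.span_sum) auto
    qed
  qed

  show "mps_coeff F m = 0" if "\<not> Poly_Mapping.keys m \<subseteq> V"
    using that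
  proof (induction "total_deg m" arbitrary: m rule: less_induct)
    case less
    then have "m \<noteq> 0" by auto
    moreover have "mps_coeff F a * mps_coeff (mps_of_fps H) b = 0" if "(a, b) \<in> add_splits m" for a b
    proof (cases "b = 0 \<or> \<not> Poly_Mapping.keys b \<subseteq> V")
      case True
      then show ?thesis using cV by (auto simp: H)
    next
      case False
      have m: "m = a + b" using that by (simp add: add_splits_def)
      then have "\<not> Poly_Mapping.keys a \<subseteq> V"
        using False less.prems by (simp add: keys_add_nat)
      moreover have "total_deg a < total_deg m"
        using False m by (simp add: total_deg_add zero_less_iff_neq_zero)
      ultimately show ?thesis using less.hyps by simp
    qed
    ultimately show ?case
      using rec by (auto intro!: sum.neutral)
  qed
qed

theorem theorem3p3:
  fixes r :: nat
    and z w :: "nat \<Rightarrow> (zwvar, rat) mps"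
    and x y :: "nat \<Rightarrow> (zwvar, rat) mps"
    and F :: "(zwvar, rat fps) mps"
  assumes "r \<ge> 1"
    and "\<forall>j\<in>{1..r}. z j = mps_var (Z j)"
    and "\<forall>j\<in>{1..r - 1}. w j = mps_var (W j)"
    and "w r = (\<Sum>j=1..r. z j) - (\<Sum>j=1..r - 1. w j)"
    and "\<forall>j\<in>{1..r}. x j = mps_exp (z j) \<and> y j = mps_exp (w j)"
    and "F = mps_of_fps (\<Prod>j=1..r.
           qpoch_inf (fps_const (x j) * fps_X) / qpoch_inf (fps_const (y j) * fps_X))"
  shows "F \<in> mps_over qMZV (zwvars r) \<and>
    mps_coeff F 0 = 1 \<and>
    (\<forall>m n :: nat \<Rightarrow> nat.
       has_weight
         (mps_coeff F ((\<Sum>j=1..r. Poly_Mapping.single (Z j) (m j)) +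
                       (\<Sum>j=1..r - 1. Poly_Mapping.single (W j) (n j))))
         ((\<Sum>j=1..r. m j) + (\<Sum>j=1..r - 1. n j)))"
proof -
  define V where "V = zwvars r"
  note z = assms(2) and w = assms(3) and wr = assms(4) and xy = assms(5) and F = assms(6)
  have z_hom: "mps_homogeneous 1 (z j)" if "j \<in> {1..r}" for j
    using z that mps_homogeneous_var by metis
  have z_supp: "mps_supported {m. Poly_Mapping.keys m \<subseteq> V} (z j)" if "j \<in> {1..r}" for j
    using z that by (auto simp: V_def zwvars_def intro!: mps_supported_var)
  have w_hom': "mps_homogeneous 1 (w j)" if "j \<in> {1..r - 1}" for j
    using w that mps_homogeneous_var by metis
  have w_supp': "mps_supported {m. Poly_Mapping.keys m \<subseteq> V} (w j)" if "j \<in> {1..r - 1}" for j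
    using w that by (auto simp: V_def zwvars_def intro!: mps_supported_var)
  \<comment> \<open>The form \<open>w r\<close> is a combination of variables rather than a
    variable, so degree and support pass to it from the other forms.\<close>
  have w_hom: "mps_homogeneous 1 (w j)" if "j \<in> {1..r}" for j
  proof (cases "j = r")
    case True
    then show ?thesis
      unfolding True wr mps_homogeneous_def
      by (intro mps_supported_diff mps_supported_sum)
         (use z_hom w_hom' in \<open>auto simp: mps_homogeneous_def\<close>)
  qed (use that w_hom' in auto)
  have w_supp: "mps_supported {m. Poly_Mapping.keys m \<subseteq> V} (w j)" if "j \<in> {1..r}" for j
  proof (cases "j = r")
    case True
    then show ?thesis
      unfolding True wr by (intro mps_supported_diff mps_supported_sum z_supp w_supp')
  qed (use that w_supp' in auto)
  have "{1..r} = insert r {1..r - 1}"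
    using assms(1) by auto
  then have "(\<Sum>j=1..r. w j) = w r + (\<Sum>j=1..r - 1. w j)"
    using assms(1) by simp
  then have balanced: "(\<Sum>j=1..r. z j) = (\<Sum>j=1..r. w j)"
    by (simp add: wr)
  have F': "F = mps_of_fps (\<Prod>j=1..r. qpoch_inf (fps_const (mps_exp (z j)) * fps_X) /
      qpoch_inf (fps_const (mps_exp (w j)) * fps_X))"
    unfolding F using xy by (intro arg_cong[of _ _ mps_of_fps] prod.cong) auto
  note coeffs = qpoch_ratio_coeffs[OF F' z_hom w_hom z_supp w_supp balanced]
  have weight: "has_weight (mps_coeff F m) (total_deg m)" for m
    by (intro span_single_bracket_products_has_weight coeffs)
  then have "F \<in> mps_over qMZV (zwvars r)"
    using coeffs(3) by (auto simp: mps_over_def has_weight_def V_def)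
  moreover have "has_weight
         (mps_coeff F ((\<Sum>j=1..r. Poly_Mapping.single (Z j) (m j)) +
                       (\<Sum>j=1..r - 1. Poly_Mapping.single (W j) (n j))))
         ((\<Sum>j=1..r. m j) + (\<Sum>j=1..r - 1. n j))" for m n
    using weight[of "(\<Sum>j=1..r. Poly_Mapping.single (Z j) (m j)) +
                       (\<Sum>j=1..r - 1. Poly_Mapping.single (W j) (n j))"]
    by (simp only: total_deg_add total_deg_sum total_deg_single)
  ultimately show ?thesis
    using coeffs(1) by blast
qed

end
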